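(* Let $\pi$ be a probability distribution on a Polish space $\mathcal{X}$ and $P$ a $\pi$-irreducible Markov transition kernel with $\pi P=\pi$. Suppose there exist a Borel set $J\subseteq\mathcal{X}$ with $\pi(J)>0$, a number $\beta>0$ and a probability measure $\nu$ such that $P(x,\cdot)\geq \beta\,\mathbf{1}(x\in J)\,\nu(\cdot)$ for all $x\in\mathcal{X}$. Let $(X_n,\Gamma_n)_{n\ge0}$ be the split chain described in the context, started with $X_0\sim\nu$, with regeneration times $0=T_0<T_1<T_2<\cdots$, cycle lengths $\tau_k=T_k-T_{k-1}$ and block sums $\Xi_k(g)=\sum_{i=T_{k-1}}^{T_k-1} g(X_i)$. Let $f:\mathcal{X}\to\mathbb{R}$ be Borel with $\pi(|f|)<\infty$, $\theta=\pi(f)$, $\bar f=f-\theta$. For a fixed integer $n\ge1$ let $R(n)=\min\{r: T_r\geq n\}$ and $$\hat\theta_{T_{R(n)}}=\frac{1}{T_{R(n)}}\sum_{i=0}^{T_{R(n)}-1} f(X_i).$$ If $\mathbb{E}(\Xi_1(\bar f))^2<\infty$ and $\mathbb{E}\tau_1^2<\infty$, then (i) $\mathbb{E}\,(\hat\theta_{T_{R(n)}}-\theta)^2\leq \frac{\sigma_{\rm as}^2(f)}{n^2}\,\mathbb{E}\,T_{R(n)}$, and (ii) $\mathbb{E}\,T_{R(n)}\leq n+n_0$, where $\sigma_{\rm as}^2(f)=\frac{\mathbb{E}(\Xi_1(\bar f))^2}{\mathbb{E}\tau_1}$ and $n_0=\frac{\mathbb{E}\tau_1^2}{\mathbb{E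}\tau_1}-1$.
   Context: Split chain: given $J,\beta,\nu$ as in the claim, define the residual kernel $Q(x,\cdot)=\frac{P(x,\cdot)-\beta\mathbf{1}(x\in J)\nu(\cdot)}{1-\beta\mathbf{1}(x\in J)}$. The bivariate Markov chain $(X_n,\Gamma_n)$ on $\mathcal{X}\times\{0,1\}$ is defined by: $\Gamma_{n-1}$ depends only on $X_{n-1}$ with $\Pr(\Gamma_{n-1}=1\mid X_{n-1}=x)=\beta\mathbf{1}(x\in J)$; given $\Gamma_{n-1}=1$, $X_n\sim\nu$; given $\Gamma_{n-1}=0$ and $X_{n-1}=x$, $X_n\sim Q(x,\cdot)$. Regeneration times: $T_0=0$ (since $X_0\sim\nu$), $T_1=\min\{n\ge1:\Gamma_{n-1}=1\}$, $T_k=\min\{n>T_{k-1}:\Gamma_{n-1}=1\}$. Throughout, $\Pr$ and $\mathbb{E}$ without subscript refer to the split chain started with $X_0\sim\nu$. *)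

theory Defs
  imports "HOL-Probability.Probability"
begin

primrec kernel_pow :: "('a::topological_space \<Rightarrow> 'a measure) \<Rightarrow> nat \<Rightarrow> 'a \<Rightarrow> 'a measure" where
  "kernel_pow P 0 = (\<lambda>x. return borel x)"
| "kernel_pow P (Suc n) = (\<lambda>x. bind (kernel_pow P n x) P)"

definition pi_irreducible :: "'a::topological_space measure \<Rightarrow> ('a \<Rightarrow> 'a measure) \<Rightarrow> bool" where
  "pi_irreducible \<pi> P \<longleftrightarrow>
     (\<forall>A\<in>sets borel. emeasure \<pi> A > 0 \<longrightarrow> (\<forall>x. \<exists>n>0. emeasure (kernel_pow P n x) A > 0))"

text \<open>Pr(Gamma = g | X = x) for the split chain.\<close>
definition split_prob :: "real \<Rightarrow> 'a set \<Rightarrow> 'a \<Rightarrow> bool \<Rightarrow> real" where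
  "split_prob \<beta> J x g = (if g then \<beta> * indicator J x else 1 - \<beta> * indicator J x)"

text \<open>Integral of h against the residual kernel
  Q(x,.) = (P(x,.) - beta 1(x in J) nu(.)) / (1 - beta 1(x in J)).\<close>
definition Q_int :: "('a \<Rightarrow> 'a measure) \<Rightarrow> real \<Rightarrow> 'a set \<Rightarrow> 'a measure \<Rightarrow> 'a \<Rightarrow> ('a \<Rightarrow> real) \<Rightarrow> real" where
  "Q_int P \<beta> J \<nu> x h =
     ((\<integral>y. h y \<partial>P x) - \<beta> * indicator J x * (\<integral>y. h y \<partial>\<nu>)) / (1 - \<beta> * indicator J x)"

text \<open>split_cyl L x = Pr(X_i in A_i and Gamma_i = g_i for all i < length L | X_0 = x),
  where L = [(A_0,g_0), ..., (A_m,g_m)]: the finite-dimensional distributions of the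
  split chain (X_n, Gamma_n).\<close>
primrec split_cyl :: "('a \<Rightarrow> 'a measure) \<Rightarrow> real \<Rightarrow> 'a set \<Rightarrow> 'a measure \<Rightarrow> ('a set \<times> bool) list \<Rightarrow> 'a \<Rightarrow> real" where
  "split_cyl P \<beta> J \<nu> [] = (\<lambda>x. 1)"
| "split_cyl P \<beta> J \<nu> (c # L) = (\<lambda>x.
     indicator (fst c) x * split_prob \<beta> J x (snd c) *
     (if snd c then (\<integral>y. split_cyl P \<beta> J \<nu> L y \<partial>\<nu>)
      else Q_int P \<beta> J \<nu> x (split_cyl P \<beta> J \<nu> L)))"

definition split_chain :: "'w measure \<Rightarrow> (nat \<Rightarrow> 'w \<Rightarrow> 'a::topological_space) \<Rightarrow> (nat \<Rightarrow> 'w \<Rightarrow> bool)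
    \<Rightarrow> ('a \<Rightarrow> 'a measure) \<Rightarrow> real \<Rightarrow> 'a set \<Rightarrow> 'a measure \<Rightarrow> bool" where
  "split_chain M X \<Gamma> P \<beta> J \<nu> \<longleftrightarrow>
     prob_space M \<and> (\<forall>i. X i \<in> M \<rightarrow>\<^sub>M borel) \<and> (\<forall>i. \<Gamma> i \<in> M \<rightarrow>\<^sub>M count_space UNIV) \<and>
     (\<forall>L. (\<forall>i<length L. fst (L ! i) \<in> sets borel) \<longrightarrow>
        measure M {w \<in> space M. \<forall>i<length L. X i w \<in> fst (L ! i) \<and> \<Gamma> i w = snd (L ! i)}
          = (\<integral>x. split_cyl P \<beta> J \<nu> L x \<partial>\<nu>))"

primrec regen_time :: "(nat \<Rightarrow> bool) \<Rightarrow> nat \<Rightarrow> nat" where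
  "regen_time \<gamma> 0 = 0"
| "regen_time \<gamma> (Suc k) = (LEAST m. m > regen_time \<gamma> k \<and> \<gamma> (m - 1))"

definition regen_index :: "(nat \<Rightarrow> bool) \<Rightarrow> nat \<Rightarrow> nat" where
  "regen_index \<gamma> n = (LEAST r. regen_time \<gamma> r \<ge> n)"

end

theory Submission
  imports Defs
begin

text \<open>
  Let \<open>\<tau>\<close> be the first regeneration time and \<open>G\<^sub>n\<close> the first regeneration time not before \<open>n\<close>, so that
  \<open>G\<^sub>n = \<tau> + G\<^bsub>n - \<tau>\<^esub> \<circ> shift\<^sub>\<tau>\<close>. Since the path after \<open>\<tau>\<close> is a copy of the whole path independent of
  the first block, \<open>a(n) = E G\<^sub>n\<close> solves the renewal equation
  \<open>a(n) = E \<tau> + \<Sum>j<n. Pr(\<tau> = j) a(n - j)\<close>. The same recursion holds for every path functional that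
  accumulates an increment per block, and its solution is proportional to the mean increment. Applied to
  the squared centred block sums up to \<open>G\<^sub>n\<close> this is Wald's second identity, which gives the first
  bound because \<open>G\<^sub>n \<ge> n\<close>.

  For the second bound, \<open>2 \<Sum>i\<le>n. G\<^sub>i + G\<^sub>n\<^sup>2 - (2n + 1) G\<^sub>n\<close> accumulates \<open>\<tau>\<^sup>2 - \<tau>\<close> per block, so its
  mean is \<open>(E \<tau>\<^sup>2 / E \<tau> - 1) a(n)\<close>. The renewal equation makes \<open>a\<close> subadditive, whence
  \<open>2 \<Sum>i\<le>n. a(i) \<ge> (n + 1) a(n)\<close>; together with \<open>E G\<^sub>n\<^sup>2 \<ge> a(n)\<^sup>2\<close> this yields the claim.

  That regeneration happens almost surely and that the block sums are centred both come from
  iterating \<open>\<pi> = \<pi>K + \<beta> \<pi>(J) \<nu>\<close>, where \<open>K = P - \<beta> 1\<^sub>J \<nu>\<close>. The partial sums of \<open>\<nu>K\<^sup>k\<close> are bounded by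
  a multiple of \<open>\<pi>\<close>, and irreducibility forces \<open>\<pi>K\<^sup>n \<rightarrow> 0\<close>, so \<open>\<pi>\<close> is a multiple of the occupation
  measure of the first block.
\<close>

section \<open>Renewal equations and Lorden's inequality\<close>

text \<open>A discrete renewal equation with constant forcing term \<open>d\<close>. The sum may
  stop at \<open>n - 1\<close> because \<open>h 0 = 0\<close>: a first cycle of length at least
  \<open>n\<close> leaves nothing more to accumulate.\<close>

definition renewal_eq :: "(nat \<Rightarrow> real) \<Rightarrow> real \<Rightarrow> (nat \<Rightarrow> real) \<Rightarrow> bool" where
  "renewal_eq p d h \<longleftrightarrow> h 0 = 0 \<and> (\<forall>n\<ge>1. h n = d + (\<Sum>j\<in>{1..<n}. p j * h (n - j)))"

lemma renewal_eqD:
  assumes "renewal_eq p d h"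
  shows "h 0 = 0" "n \<ge> 1 \<Longrightarrow> h n = d + (\<Sum>j\<in>{1..<n}. p j * h (n - j))"
  using assms by (auto simp: renewal_eq_def)

text \<open>The equation is linear and determines its solution recursively, so \<open>m * h\<close>
  and \<open>d * a\<close>, which share the forcing term \<open>m * d\<close>, must agree. The
  product form needs no assumption on \<open>m\<close>.\<close>

lemma renewal_eq_proportional:
  assumes h: "renewal_eq p d h" and a: "renewal_eq p m a"
  shows "m * h n = d * a n"
proof (induction n rule: less_induct)
  case (less n)
  show ?case
  proof (cases "n \<ge> 1")
    case True
    have "(\<Sum>j\<in>{1..<n}. p j * (m * h (n - j))) = (\<Sum>j\<in>{1..<n}. p j * (d * a (n - j)))"
      using less.IH by (intro sum.cong) auto
    then have "m * (\<Sum>j\<in>{1..<n}. p j * h (n - j)) = d * (\<Sum>j\<in>{1..<n}. p j * a (n - j))"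
      by (simp add: sum_distrib_left algebra_simps)
    then show ?thesis
      using renewal_eqD(2)[OF h True] renewal_eqD(2)[OF a True] by (simp add: algebra_simps)
  next
    case False
    then show ?thesis using renewal_eqD(1)[OF h] renewal_eqD(1)[OF a] by (simp add: not_le)
  qed
qed

context
  fixes p :: "nat \<Rightarrow> real" and m :: real and a :: "nat \<Rightarrow> real"
  assumes p_nonneg: "\<And>j. 0 \<le> p j" and m_nonneg: "0 \<le> m" and ren: "renewal_eq p m a"
begin

lemma renewal_nonneg: "0 \<le> a n"
proof (induction n rule: less_induct)
  case (less n)
  show ?case
  proof (cases "n \<ge> 1")
    case True
    show ?thesis unfolding renewal_eqD(2)[OF ren True]
      by (intro add_nonneg_nonneg sum_nonneg mult_nonneg_nonneg p_nonneg m_nonneg less.IH) auto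
  next
    case False
    then show ?thesis using renewal_eqD(1)[OF ren] by (simp add: not_le)
  qed
qed

text \<open>Passing from \<open>n\<close> to \<open>Suc n\<close> raises each argument in the sum by
  one, which the induction hypothesis controls, and adds one non-negative summand.\<close>

lemma renewal_mono_Suc: "a n \<le> a (Suc n)"
proof (induction n rule: less_induct)
  case (less n)
  show ?case
  proof (cases "n \<ge> 1")
    case True
    have "(\<Sum>j\<in>{1..<n}. p j * a (n - j)) \<le> (\<Sum>j\<in>{1..<n}. p j * a (Suc n - j))"
    proof (intro sum_mono mult_left_mono p_nonneg)
      fix j assume "j \<in> {1..<n}"
      then show "a (n - j) \<le> a (Suc n - j)"
        using less[of "n - j"] by (auto simp: Suc_diff_le)
    qed
    also have "\<dots> \<le> (\<Sum>j\<in>{1..<Suc n}. p j * a (Suc n - j))"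
      by (intro sum_mono2) (auto intro!: mult_nonneg_nonneg p_nonneg renewal_nonneg)
    finally show ?thesis using renewal_eqD(2)[OF ren, of n] renewal_eqD(2)[OF ren, of "Suc n"] True
      by auto
  next
    case False
    then show ?thesis using renewal_eqD(1)[OF ren] renewal_nonneg[of 1] by (simp add: not_le)
  qed
qed

lemma renewal_mono: "k \<le> l \<Longrightarrow> a k \<le> a l"
  using renewal_mono_Suc by (rule lift_Suc_mono_le)

text \<open>Induction on \<open>n\<close> in the renewal equation for \<open>a (n + k)\<close>:
  summands with \<open>j < n\<close> split off \<open>a k\<close> by the induction hypothesis, the
  others are at most \<open>a k\<close> by monotonicity. Since \<open>p\<close> has mass at most
  one, a single copy of \<open>a k\<close> suffices.\<close>

lemma renewal_subadditive:
  assumes p_le: "\<And>n. (\<Sum>j\<in>{1..<n}. p j) \<le> 1"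
  shows "a (n + k) \<le> a n + a k"
proof (induction n rule: less_induct)
  case (less n)
  show ?case
  proof (cases "n \<ge> 1")
    case True
    have "a (n + k) = m + (\<Sum>j\<in>{1..<n + k}. p j * a (n + k - j))"
      using True by (intro renewal_eqD(2)[OF ren]) simp
    also have "(\<Sum>j\<in>{1..<n + k}. p j * a (n + k - j))
        \<le> (\<Sum>j\<in>{1..<n + k}. p j * ((if j < n then a (n - j) else 0) + a k))"
    proof (intro sum_mono mult_left_mono p_nonneg)
      fix j assume j: "j \<in> {1..<n + k}"
      show "a (n + k - j) \<le> (if j < n then a (n - j) else 0) + a k"
      proof (cases "j < n")
        case True
        then show ?thesis using less[of "n - j"] j by auto
      next
        case False
        then show ?thesis by (auto intro: renewal_mono)
      qed
    qed
    also have "\<dots> = (\<Sum>j\<in>{1..<n + k}. if j < n then p j * a (n - j) else 0) + (\<Sum>j\<in>{1..<n + k}. p j) * a k"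
      unfolding sum_distrib_right sum.distrib[symmetric] by (intro sum.cong) (auto simp: ring_distribs)
    also have "(\<Sum>j\<in>{1..<n + k}. if j < n then p j * a (n - j) else 0) = (\<Sum>j\<in>{1..<n}. p j * a (n - j))"
      by (intro sum.mono_neutral_cong_right) auto
    also have "(\<Sum>j\<in>{1..<n + k}. p j) * a k \<le> 1 * a k"
      by (intro mult_right_mono p_le renewal_nonneg)
    finally show ?thesis using renewal_eqD(2)[OF ren True] by simp
  next
    case False
    then show ?thesis using renewal_eqD(1)[OF ren] by (simp add: not_le)
  qed
qed

text \<open>In the application \<open>q\<close> is the second moment of the first renewal epoch not before \<open>n\<close>, and
  \<open>sum_identity\<close> computes the sum of the mean residual life times at \<open>0, \<dots>, n\<close>.\<close>

lemma lorden:
  assumes p_le: "\<And>n. (\<Sum>j\<in>{1..<n}. p j) \<le> 1" and m_pos: "0 < m" and n: "1 \<le> n"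
    and q: "(a n)\<^sup>2 \<le> q"
    and sum_identity: "2 * (\<Sum>i\<le>n. a i) + q - (2 * real n + 1) * a n = c * a n"
  shows "a n \<le> real n + c"
proof -
  \<comment> \<open>Subadditivity is added up over all splittings \<open>n = i + (n - i)\<close>;
    reversing the order of summation shows that the two sums on the right coincide.\<close>
  have "(\<Sum>i\<le>n. a n) \<le> (\<Sum>i\<le>n. a i + a (n - i))"
  proof (intro sum_mono)
    fix i assume "i \<in> {..n}"
    then show "a n \<le> a i + a (n - i)" using renewal_subadditive[OF p_le, of i "n - i"] by simp
  qed
  also have "\<dots> = (\<Sum>i\<le>n. a i) + (\<Sum>i\<le>n. a (n - i))"
    by (simp add: sum.distrib)
  also have "(\<Sum>i\<le>n. a (n - i)) = (\<Sum>i\<le>n. a i)"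
    by (rule sum.reindex_bij_witness[of _ "\<lambda>i. n - i" "\<lambda>i. n - i"]) auto
  finally have "(real n + 1) * a n \<le> 2 * (\<Sum>i\<le>n. a i)"
    by (simp add: algebra_simps)
  with q sum_identity have "a n * a n \<le> a n * (real n + c)"
    by (simp add: algebra_simps power2_eq_square)
  \<comment> \<open>Strict positivity permits cancelling one factor \<open>a n\<close> in the
    quadratic inequality.\<close>
  moreover have "0 < a n"
    unfolding renewal_eqD(2)[OF ren n]
    by (intro add_pos_nonneg sum_nonneg mult_nonneg_nonneg p_nonneg renewal_nonneg m_pos)
  ultimately show ?thesis by simp
qed

end

section \<open>Pathwise arithmetic of regeneration times\<close>

definition first_regen :: "(nat \<Rightarrow> bool) \<Rightarrow> nat" where
  "first_regen \<gamma> = regen_time \<gamma> 1"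

text \<open>This is \<open>G\<^sub>n\<close> of the overview. \<open>LEAST\<close> is meaningful
  only if its search succeeds, so the lower bound and the recursion below are stated for sequences
  with infinitely many set flags.\<close>

definition next_regen :: "nat \<Rightarrow> (nat \<Rightarrow> bool) \<Rightarrow> nat" where
  "next_regen n \<gamma> = regen_time \<gamma> (regen_index \<gamma> n)"

text \<open>A regeneration at time \<open>j\<close> is triggered by the flag at time
  \<open>j - 1\<close>, hence the shift by one in the indices.\<close>

lemma first_regen_eqI:
  assumes "j \<ge> 1" "\<gamma> (j - 1)" "\<And>i. i < j - 1 \<Longrightarrow> \<not> \<gamma> i"
  shows "first_regen \<gamma> = j"
  unfolding first_regen_def using assms
  by (auto intro!: Least_equality) (metis Suc_pred diff_less_mono leI less_Suc_eq_le not_less_eq)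

lemma first_regen_eq_Suc_Least:
  assumes "\<exists>i. \<gamma> i"
  shows "first_regen \<gamma> = Suc (LEAST i. \<gamma> i)"
proof (rule first_regen_eqI)
  show "\<gamma> (Suc (LEAST i. \<gamma> i) - 1)" using LeastI_ex[OF assms] by simp
  show "\<not> \<gamma> i" if "i < Suc (LEAST i. \<gamma> i) - 1" for i
    using not_less_Least[of i \<gamma>] that by simp
qed simp

lemma first_regen_cases:
  assumes "\<exists>i. \<gamma> i"
  shows "first_regen \<gamma> \<ge> 1" "\<gamma> (first_regen \<gamma> - 1)" "i < first_regen \<gamma> - 1 \<Longrightarrow> \<not> \<gamma> i"
  unfolding first_regen_eq_Suc_Least[OF assms]
  using LeastI_ex[OF assms] not_less_Least[of i \<gamma>] by simp_all

lemma first_regen_eq_iff: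
  assumes "\<exists>i. \<gamma> i" "j \<ge> 1"
  shows "first_regen \<gamma> = j \<longleftrightarrow> \<gamma> (j - 1) \<and> (\<forall>i<j - 1. \<not> \<gamma> i)"
  using first_regen_cases(2,3)[OF assms(1)] first_regen_eqI[of j \<gamma>, OF assms(2)] by blast

lemma less_first_regen_iff:
  assumes "\<exists>i. \<gamma> i"
  shows "k < first_regen \<gamma> \<longleftrightarrow> (\<forall>i<k. \<not> \<gamma> i)"
proof
  assume "k < first_regen \<gamma>"
  then have "i < first_regen \<gamma> - 1" if "i < k" for i using that by linarith
  then show "\<forall>i<k. \<not> \<gamma> i" using first_regen_cases(3)[OF assms] by blast
next
  assume *: "\<forall>i<k. \<not> \<gamma> i"
  show "k < first_regen \<gamma>"
  proof (rule ccontr)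
    assume "\<not> k < first_regen \<gamma>"
    then have "first_regen \<gamma> - 1 < k" using first_regen_cases(1)[OF assms] by simp
    with * first_regen_cases(2)[OF assms] show False by blast
  qed
qed

text \<open>By induction both searches start at the same place up to translation by the first
  regeneration time. A set flag beyond that place makes the translated search succeed, and
  translation then carries one minimum to the other.\<close>

lemma regen_time_shift:
  assumes inf: "\<And>k. \<exists>i\<ge>k. \<gamma> i"
  shows "regen_time \<gamma> (Suc k) = first_regen \<gamma> + regen_time (\<lambda>i. \<gamma> (first_regen \<gamma> + i)) k"
proof (induction k)
  case 0
  show ?case by (simp add: first_regen_def)
next
  case (Suc k)
  let ?t = "first_regen \<gamma>" and ?\<gamma> = "\<lambda>i. \<gamma> (first_regen \<gamma> + i)"
  let ?P = "\<lambda>m. m > regen_time \<gamma> (Suc k) \<and> \<gamma> (m - 1)"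
  let ?Q = "\<lambda>m. m > regen_time ?\<gamma> k \<and> ?\<gamma> (m - 1)"
  obtain i where i: "i \<ge> ?t + regen_time ?\<gamma> k" "\<gamma> i" using inf by blast
  have "?Q (Suc i - ?t)" using i by (auto simp del: regen_time.simps simp: Suc_diff_le)
  then have Q: "?Q (Least ?Q)" by (rule LeastI)
  have eq: "Least ?P = ?t + Least ?Q"
  proof (rule Least_equality)
    show "?P (?t + Least ?Q)" using Q Suc.IH by (auto simp del: regen_time.simps)
  next
    fix y assume y: "?P y"
    then have "?Q (y - ?t)" using Suc.IH by (auto simp del: regen_time.simps)
    then have "Least ?Q \<le> y - ?t" by (rule Least_le)
    then show "?t + Least ?Q \<le> y" using y Suc.IH by (auto simp del: regen_time.simps)
  qed
  have "regen_time \<gamma> (Suc (Suc k)) = Least ?P" "regen_time ?\<gamma> (Suc k) = Least ?Q"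
    by (rule regen_time.simps(2))+
  with eq show ?case by metis
qed

lemma regen_time_ge:
  assumes inf: "\<And>k. \<exists>i\<ge>k. \<gamma> i"
  shows "regen_time \<gamma> k \<ge> k"
proof (induction k)
  case (Suc k)
  obtain i where "i \<ge> regen_time \<gamma> k" "\<gamma> i" using inf by blast
  then have "Suc i > regen_time \<gamma> k \<and> \<gamma> (Suc i - 1)" by auto
  from LeastI[of "\<lambda>m. m > regen_time \<gamma> k \<and> \<gamma> (m - 1)", OF this] Suc show ?case by simp
qed simp

lemma next_regen_0: "next_regen 0 \<gamma> = 0"
proof -
  have "regen_index \<gamma> 0 = 0" unfolding regen_index_def by (rule Least_equality) auto
  then show ?thesis by (simp add: next_regen_def)
qed

lemma next_regen_ge:
  assumes inf: "\<And>k. \<exists>i\<ge>k. \<gamma> i"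
  shows "next_regen n \<gamma> \<ge> n"
  unfolding next_regen_def regen_index_def
  using regen_time_ge[OF inf, of n] by (rule LeastI)

text \<open>Positivity of \<open>n\<close> rules out index \<open>0\<close>, so the search begins at
  the first regeneration. If that one already reaches \<open>n\<close>, truncated subtraction turns
  the second summand into \<open>next_regen 0\<close>, which is \<open>0\<close>.\<close>

lemma next_regen_shift:
  assumes inf: "\<And>k. \<exists>i\<ge>k. \<gamma> i" and n: "n \<ge> 1"
  shows "next_regen n \<gamma> = first_regen \<gamma> + next_regen (n - first_regen \<gamma>) (\<lambda>i. \<gamma> (first_regen \<gamma> + i))"
proof -
  have "regen_index \<gamma> n = Suc (LEAST r. regen_time \<gamma> (Suc r) \<ge> n)"
    unfolding regen_index_def using n regen_time_ge[OF inf, of n] by (intro Least_Suc) auto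
  also have "(LEAST r. regen_time \<gamma> (Suc r) \<ge> n)
      = regen_index (\<lambda>i. \<gamma> (first_regen \<gamma> + i)) (n - first_regen \<gamma>)"
    unfolding regen_index_def regen_time_shift[OF inf] by (rule arg_cong[where f=Least]) auto
  finally show ?thesis
    by (simp only: next_regen_def regen_time_shift[OF inf])
qed

lemma measurable_regen_time[measurable (raw)]:
  assumes [measurable]: "\<And>i. Measurable.pred N (\<lambda>w. \<gamma> w i)"
  shows "(\<lambda>w. regen_time (\<gamma> w) k) \<in> N \<rightarrow>\<^sub>M count_space UNIV"
proof (induction k)
  case (Suc k)
  then have [measurable]: "(\<lambda>w. regen_time (\<gamma> w) k) \<in> N \<rightarrow>\<^sub>M count_space UNIV" .
  show ?case unfolding regen_time.simps by measurable
qed simp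

lemma measurable_next_regen[measurable (raw)]:
  assumes [measurable]: "\<And>i. Measurable.pred N (\<lambda>w. \<gamma> w i)"
  shows "(\<lambda>w. next_regen n (\<gamma> w)) \<in> N \<rightarrow>\<^sub>M count_space UNIV"
proof -
  have [measurable]: "(\<lambda>w. regen_index (\<gamma> w) n) \<in> N \<rightarrow>\<^sub>M count_space UNIV"
    unfolding regen_index_def by measurable
  show ?thesis unfolding next_regen_def
    by (rule measurable_compose_countable[of "\<lambda>k w. regen_time (\<gamma> w) k"]) auto
qed

lemma measurable_first_regen[measurable (raw)]:
  assumes [measurable]: "\<And>i. Measurable.pred N (\<lambda>w. \<gamma> w i)"
  shows "(\<lambda>w. first_regen (\<gamma> w)) \<in> N \<rightarrow>\<^sub>M count_space UNIV"
  unfolding first_regen_def by measurable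

section \<open>Regenerative path laws\<close>

abbreviation path_space :: "(nat \<Rightarrow> 'a::topological_space \<times> bool) measure" where
  "path_space \<equiv> \<Pi>\<^sub>M i\<in>UNIV. borel \<Otimes>\<^sub>M count_space UNIV"

definition path_shift :: "nat \<Rightarrow> (nat \<Rightarrow> 'b) \<Rightarrow> nat \<Rightarrow> 'b" where
  "path_shift j z = (\<lambda>i. z (j + i))"

abbreviation cycle_len :: "(nat \<Rightarrow> 'a \<times> bool) \<Rightarrow> nat" where
  "cycle_len z \<equiv> first_regen (\<lambda>i. snd (z i))"

text \<open>The event that the first cycle has length \<open>j\<close>, written through the first
  \<open>j\<close> coordinates only so that no search for a minimum is involved. The formula gives
  the same event for \<open>j = 0\<close> and \<open>j = 1\<close>; this is why later facts require
  \<open>j \<ge> 1\<close>.\<close>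

definition cycle_is :: "nat \<Rightarrow> (nat \<Rightarrow> 'a \<times> bool) \<Rightarrow> bool" where
  "cycle_is j z \<longleftrightarrow> snd (z (j - 1)) \<and> (\<forall>i<j - 1. \<not> snd (z i))"

text \<open>Dependence on the first block alone, expressed as invariance: once the first cycle has
  ended, the rest of the path may be replaced by any other path.\<close>

definition block_functional :: "((nat \<Rightarrow> 'a \<times> bool) \<Rightarrow> real) \<Rightarrow> bool" where
  "block_functional D \<longleftrightarrow> (\<forall>j\<ge>1. \<forall>z z'. cycle_is j z \<longrightarrow> D (comb_seq j z z') = D z)"

definition inf_regen :: "(nat \<Rightarrow> 'a \<times> bool) \<Rightarrow> bool" where
  "inf_regen z \<longleftrightarrow> (\<forall>k. \<exists>i\<ge>k. snd (z i))"

lemma inf_regenD: "inf_regen z \<Longrightarrow> \<exists>i\<ge>k. snd (z i)"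
  by (simp add: inf_regen_def)

lemma cycle_is_iff:
  assumes "\<exists>i. snd (z i)" "j \<ge> 1"
  shows "cycle_is j z \<longleftrightarrow> cycle_len z = j"
  using first_regen_eq_iff[of "\<lambda>i. snd (z i)" j] assms by (auto simp: cycle_is_def)

lemma cycle_is_imp_cycle: "cycle_is j z \<Longrightarrow> j \<ge> 1 \<Longrightarrow> cycle_len z = j"
  by (intro first_regen_eqI) (auto simp: cycle_is_def)

lemma cycle_is_comb_seq: "j \<ge> 1 \<Longrightarrow> cycle_is j (comb_seq j z z') \<longleftrightarrow> cycle_is j z"
  by (auto simp: cycle_is_def comb_seq_def)

lemma path_shift_comb_seq: "path_shift j (comb_seq j z z') = z'"
  by (auto simp: path_shift_def comb_seq_def)

lemma measurable_snd_path[measurable]: "Measurable.pred path_space (\<lambda>z. snd (z i))"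
  by measurable

lemma measurable_fst_path[measurable]: "(\<lambda>z. fst (z i)) \<in> path_space \<rightarrow>\<^sub>M borel"
  by measurable

lemma measurable_cycle_is[measurable]: "Measurable.pred path_space (cycle_is j)"
  unfolding cycle_is_def by measurable

lemma measurable_path_shift[measurable]:
  "path_shift j \<in> path_space \<rightarrow>\<^sub>M path_space"
  unfolding path_shift_def by (rule measurable_PiM_single') (auto simp: space_PiM space_pair_measure)

text \<open>The assumption \<open>regen\<close> states regeneration at a fixed time without
  conditional probabilities: restricted to the event that flag \<open>m\<close> is set, the law is
  that of the first \<open>m + 1\<close> coordinates followed by an independent path with law
  \<open>L\<close>.\<close>

locale regenerative = prob_space L
  for L :: "(nat \<Rightarrow> 'a::topological_space \<times> bool) measure" +
  assumes sets_L[measurable_cong]: "sets L = sets path_space"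
    and regen: "density L (\<lambda>z. ennreal (if snd (z m) then 1 else 0)) =
      distr (density L (\<lambda>z. ennreal (if snd (z m) then 1 else 0)) \<Otimes>\<^sub>M L) path_space
        (\<lambda>(z, z'). comb_seq (Suc m) z z')"
    and AE_ex_regen: "AE z in L. \<exists>i. snd (z i)"
begin

lemma measurable_comp_path_shift:
  assumes "H \<in> path_space \<rightarrow>\<^sub>M N"
  shows "(\<lambda>z. H (path_shift j z)) \<in> path_space \<rightarrow>\<^sub>M N"
  by (rule measurable_compose[OF measurable_path_shift assms])

text \<open>After rewriting the restricted law by \<open>regen\<close>, \<open>D\<close> sees only
  the first path and the shifted \<open>H\<close> only the second, so Tonelli gives a
  product.\<close>

lemma regen_nn_integral:
  assumes meas[measurable]: "D \<in> borel_measurable path_space" "H \<in> borel_measurable path_space"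
    and D: "\<And>z. D z \<noteq> 0 \<Longrightarrow> snd (z m)" "\<And>z z'. D (comb_seq (Suc m) z z') = D z"
  shows "(\<integral>\<^sup>+z. D z * H (path_shift (Suc m) z) \<partial>L) = (\<integral>\<^sup>+z. D z \<partial>L) * (\<integral>\<^sup>+z. H z \<partial>L)"
proof -
  define I where "I = (\<lambda>z :: nat \<Rightarrow> 'a \<times> bool. ennreal (if snd (z m) then 1 else 0))"
  define S where "S = (\<lambda>z. H (path_shift (Suc m) z))"
  have S_comb: "S (comb_seq (Suc m) z z') = H z'" for z z'
    by (simp add: S_def path_shift_comb_seq)
  have [measurable]: "I \<in> borel_measurable path_space"
    unfolding I_def by measurable
  have [measurable]: "S \<in> borel_measurable path_space"
    unfolding S_def by (rule measurable_comp_path_shift) fact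
  note reg = regen[of m, folded I_def]
  \<comment> \<open>\<open>D\<close> vanishes wherever the flag is off, so the indicator can be
    inserted and removed freely.\<close>
  have I: "I z * D z = D z" for z using D(1)[of z] by (auto simp: I_def)
  have "(\<integral>\<^sup>+z. D z * S z \<partial>L) = (\<integral>\<^sup>+z. I z * (D z * S z) \<partial>L)"
    by (simp only: mult.assoc[symmetric] I)
  also have "\<dots> = (\<integral>\<^sup>+z. D z * S z \<partial>density L I)"
    by (rule nn_integral_density[symmetric]) measurable
  also have "\<dots> = (\<integral>\<^sup>+z. D z * S z \<partial>distr (density L I \<Otimes>\<^sub>M L) path_space (\<lambda>(z, z'). comb_seq (Suc m) z z'))"
    by (subst reg) (rule refl)
  also have "\<dots> = (\<integral>\<^sup>+p. (case p of (z, z') \<Rightarrow> D z * H z') \<partial>(density L I \<Otimes>\<^sub>M L))"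
    by (subst nn_integral_distr) (measurable, simp add: case_prod_unfold D(2) S_comb)
  also have "\<dots> = (\<integral>\<^sup>+z. \<integral>\<^sup>+z'. D z * H z' \<partial>L \<partial>density L I)"
    by (subst nn_integral_fst[symmetric]) auto
  also have "\<dots> = (\<integral>\<^sup>+z. D z * (\<integral>\<^sup>+z'. H z' \<partial>L) \<partial>density L I)"
    by (intro nn_integral_cong nn_integral_cmult) measurable
  also have "\<dots> = (\<integral>\<^sup>+z. I z * (D z * (\<integral>\<^sup>+z'. H z' \<partial>L)) \<partial>L)"
    by (rule nn_integral_density) measurable
  also have "\<dots> = (\<integral>\<^sup>+z. D z \<partial>L) * (\<integral>\<^sup>+z. H z \<partial>L)"
    unfolding mult.assoc[symmetric] I by (rule nn_integral_multc) measurable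
  finally show ?thesis by (simp only: S_def)
qed

text \<open>The signed version. The restricted measure \<open>N\<close> is finite, so Fubini applies
  and yields integrability of the product as well as its value.\<close>

lemma regen_integral:
  fixes D H :: "_ \<Rightarrow> real"
  assumes int: "integrable L D" "integrable L H"
    and D: "\<And>z. D z \<noteq> 0 \<Longrightarrow> snd (z m)" "\<And>z z'. D (comb_seq (Suc m) z z') = D z"
  shows "integrable L (\<lambda>z. D z * H (path_shift (Suc m) z))"
    and "(\<integral>z. D z * H (path_shift (Suc m) z) \<partial>L) = (\<integral>z. D z \<partial>L) * (\<integral>z. H z \<partial>L)"
proof -
  have meas[measurable]: "D \<in> borel_measurable path_space" "H \<in> borel_measurable path_space"
    using borel_measurable_integrable[OF int(1)] borel_measurable_integrable[OF int(2)]
    by (simp_all only: measurable_cong_sets[OF sets_L refl])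
  define I where "I = (\<lambda>z :: nat \<Rightarrow> 'a \<times> bool. if snd (z m) then 1 else 0 :: real)"
  define S where "S = (\<lambda>z. H (path_shift (Suc m) z))"
  have S_comb: "S (comb_seq (Suc m) z z') = H z'" for z z'
    by (simp add: S_def path_shift_comb_seq)
  have I_nonneg: "0 \<le> I z" for z by (simp add: I_def)
  have [measurable]: "I \<in> borel_measurable path_space"
    unfolding I_def by measurable
  have [measurable]: "S \<in> borel_measurable path_space"
    unfolding S_def by (rule measurable_comp_path_shift) fact
  define N where "N = density L (\<lambda>z. ennreal (I z))"
  have [measurable_cong]: "sets N = sets path_space" by (simp add: N_def sets_L)
  have reg: "N = distr (N \<Otimes>\<^sub>M L) path_space (\<lambda>(z, z'). comb_seq (Suc m) z z')"
    using regen[of m] by (simp only: N_def I_def)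
  have I: "I z * D z = D z" for z using D(1)[of z] by (auto simp: I_def)
  have "emeasure N (space N) \<le> (\<integral>\<^sup>+z. 1 \<partial>L)"
  proof -
    have "emeasure N (space N) = (\<integral>\<^sup>+z. ennreal (I z) * indicator (space L) z \<partial>L)"
      unfolding N_def by (subst emeasure_density) auto
    also have "\<dots> \<le> (\<integral>\<^sup>+z. 1 \<partial>L)"
      by (intro nn_integral_mono) (auto simp: I_def)
    finally show ?thesis .
  qed
  then interpret N: finite_measure N
    by (intro finite_measureI) (auto simp: emeasure_space_1 top_unique)
  interpret NL: pair_sigma_finite N L by standard
  have dens: "integrable N g \<longleftrightarrow> integrable L (\<lambda>z. I z *\<^sub>R g z)"
      "integral\<^sup>L N g = (\<integral>z. I z *\<^sub>R g z \<partial>L)"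
    if [measurable]: "g \<in> borel_measurable path_space" for g :: "_ \<Rightarrow> real"
    unfolding N_def by (rule integrable_density integral_density; simp add: I_nonneg)+
  have DN: "integrable N D" "integral\<^sup>L N D = integral\<^sup>L L D"
    by (simp_all add: dens I int)
  have prod: "integrable (N \<Otimes>\<^sub>M L) (\<lambda>p. D (fst p) * H (snd p))"
    by (rule NL.Fubini_integrable) (auto simp: abs_mult intro!: integrable_mult_left DN int)
  have comb: "(\<lambda>p. D (case_prod (comb_seq (Suc m)) p) * S (case_prod (comb_seq (Suc m)) p)) = (\<lambda>p. D (fst p) * H (snd p))"
    by (simp add: fun_eq_iff D(2) S_comb)
  have "integrable (distr (N \<Otimes>\<^sub>M L) path_space (\<lambda>(z, z'). comb_seq (Suc m) z z')) (\<lambda>z. D z * S z)"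
    by (subst integrable_distr_eq) (measurable, simp only: comb prod)
  then have "integrable N (\<lambda>z. D z * S z)"
    by (subst reg)
  then have "integrable L (\<lambda>z. I z *\<^sub>R (D z * S z))"
    by (subst (asm) dens) measurable
  then show "integrable L (\<lambda>z. D z * H (path_shift (Suc m) z))"
    by (simp only: real_scaleR_def mult.assoc[symmetric] I S_def)
  have "(\<integral>z. D z * S z \<partial>L) = (\<integral>z. I z *\<^sub>R (D z * S z) \<partial>L)"
    by (simp only: real_scaleR_def mult.assoc[symmetric] I)
  also have "\<dots> = (\<integral>z. D z * S z \<partial>N)"
    by (rule dens(2)[symmetric]) measurable
  also have "\<dots> = (\<integral>z. D z * S z \<partial>distr (N \<Otimes>\<^sub>M L) path_space (\<lambda>(z, z'). comb_seq (Suc m) z z'))"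
    by (subst reg) (rule refl)
  also have "\<dots> = (\<integral>p. D (fst p) * H (snd p) \<partial>(N \<Otimes>\<^sub>M L))"
    by (subst integral_distr) (measurable, simp only: comb)
  also have "\<dots> = (\<integral>z. \<integral>z'. D z * H z' \<partial>L \<partial>N)"
    using NL.integral_fst'[OF prod] by simp
  also have "\<dots> = integral\<^sup>L L D * integral\<^sup>L L H"
    by (simp add: DN)
  finally show "(\<integral>z. D z * H (path_shift (Suc m) z) \<partial>L) = integral\<^sup>L L D * integral\<^sup>L L H"
    by (simp only: S_def)
qed

text \<open>That the last set flag stands at time \<open>m\<close> has probability Pr(flag
  \<open>m\<close> set) times Pr(no flag ever), which is zero. Excluding this for the countably many
  \<open>m\<close> leaves paths whose flags never stop.\<close>

lemma AE_inf_regen: "AE z in L. inf_regen z"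
proof -
  have "AE z in L. \<not> (snd (z m) \<and> (\<forall>i. \<not> snd (z (Suc m + i))))" for m
  proof -
    let ?D = "\<lambda>z. if snd (z m) then 1 else 0 :: ennreal"
    let ?H = "\<lambda>z. if \<forall>i. \<not> snd (z i) then 1 else 0 :: ennreal"
    have "(\<integral>\<^sup>+z. ?H z \<partial>L) = 0"
      using AE_ex_regen by (subst nn_integral_0_iff_AE) (auto elim!: eventually_mono)
    then have "(\<integral>\<^sup>+z. ?D z * ?H (path_shift (Suc m) z) \<partial>L) = 0"
      by (subst regen_nn_integral) (auto simp: comb_seq_def split: if_splits)
    then show ?thesis
      by (subst (asm) nn_integral_0_iff_AE) (auto simp: path_shift_def split: if_splits elim!: eventually_mono)
  qed
  then have "AE z in L. \<forall>m. \<not> (snd (z m) \<and> (\<forall>i. \<not> snd (z (Suc m + i))))"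
    by (subst AE_all_countable) auto
  with AE_ex_regen show ?thesis
  proof eventually_elim
    case (elim z)
    have "\<exists>i\<ge>k. snd (z i)" for k
    proof (induction k)
      case 0
      then show ?case using elim by auto
    next
      case (Suc k)
      then obtain i where i: "i \<ge> k" "snd (z i)" by auto
      with elim obtain l where "snd (z (Suc i + l))" by blast
      with i show ?case by (intro exI[of _ "Suc i + l"]) auto
    qed
    then show ?case by (simp add: inf_regen_def)
  qed
qed

text \<open>The law of the first cycle length for \<open>j \<ge> 1\<close>. The value at
  \<open>0\<close> repeats the one at \<open>1\<close>, so sums start at \<open>1\<close>.\<close>

definition cycle_pmf :: "nat \<Rightarrow> real" where
  "cycle_pmf j = (\<integral>z. (if cycle_is j z then 1 else 0) \<partial>L)"

lemma cycle_pmf_nonneg: "0 \<le> cycle_pmf j"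
  unfolding cycle_pmf_def by (rule integral_nonneg_AE) auto

lemma integrable_mult_cycle_is:
  assumes "integrable L D"
  shows "integrable L (\<lambda>z. D z * (if cycle_is j z then 1 else 0) :: real)"
  by (rule Bochner_Integration.integrable_bound[OF assms])
    (auto intro!: borel_measurable_times borel_measurable_integrable[OF assms])

lemma integrable_cycle_is: "integrable L (\<lambda>z. if cycle_is j z then 1 else 0 :: real)"
  using integrable_mult_cycle_is[of "\<lambda>_. 1" j] by simp

lemma sum_cycle_pmf_le_1: "(\<Sum>j\<in>{1..<n}. cycle_pmf j) \<le> 1"
proof -
  have "(\<Sum>j\<in>{1..<n}. cycle_pmf j) = (\<integral>z. (\<Sum>j\<in>{1..<n}. if cycle_is j z then 1 else 0) \<partial>L)"
    unfolding cycle_pmf_def by (rule Bochner_Integration.integral_sum[symmetric]) (rule integrable_cycle_is)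
  also have "\<dots> \<le> (\<integral>z. 1 \<partial>L)"
  proof (rule integral_mono)
    fix z
    have "(\<Sum>j\<in>{1..<n}. if cycle_is j z then 1 else 0 :: real) \<le> (\<Sum>j\<in>{1..<n}. if j = cycle_len z then 1 else 0)"
      by (intro sum_mono) (auto dest: cycle_is_imp_cycle)
    also have "\<dots> \<le> 1" by simp
    finally show "(\<Sum>j\<in>{1..<n}. if cycle_is j z then 1 else 0 :: real) \<le> 1" .
  qed (intro Bochner_Integration.integrable_sum integrable_cycle_is, simp)
  finally show ?thesis by (simp add: prob_space)
qed

text \<open>This is \<open>regen_integral\<close> at \<open>m = j - 1\<close>:
  \<open>cycle_is j\<close> forces that flag to be set, and its product with a block functional
  reads only the first \<open>j\<close> coordinates.\<close>

lemma first_cycle_integral: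
  fixes D H :: "_ \<Rightarrow> real"
  assumes D: "integrable L D" "block_functional D" and H: "integrable L H" and j: "j \<ge> 1"
  shows "integrable L (\<lambda>z. D z * (if cycle_is j z then 1 else 0) * H (path_shift j z))"
    and "(\<integral>z. D z * (if cycle_is j z then 1 else 0) * H (path_shift j z) \<partial>L)
      = (\<integral>z. D z * (if cycle_is j z then 1 else 0) \<partial>L) * (\<integral>z. H z \<partial>L)"
proof -
  let ?D = "\<lambda>z. D z * (if cycle_is j z then 1 else 0)"
  have Suc: "Suc (j - 1) = j" using j by simp
  have "?D z \<noteq> 0 \<Longrightarrow> snd (z (j - 1))" for z by (auto simp: cycle_is_def split: if_splits)
  moreover have "?D (comb_seq (Suc (j - 1)) z z') = ?D z" for z z'
    using D(2) j by (auto simp: Suc cycle_is_comb_seq block_functional_def)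
  ultimately show "integrable L (\<lambda>z. ?D z * H (path_shift j z))"
    and "(\<integral>z. ?D z * H (path_shift j z) \<partial>L) = (\<integral>z. ?D z \<partial>L) * (\<integral>z. H z \<partial>L)"
    using regen_integral[OF integrable_mult_cycle_is[OF D(1)] H, of j "j - 1"] unfolding Suc by blast+
qed

lemma block_functional_1: "block_functional (\<lambda>_. 1)"
  by (simp add: block_functional_def)

section \<open>Renewal equations for path functionals that gain \<open>D\<close> in every
  block\<close>

context
  fixes D :: "(nat \<Rightarrow> 'a \<times> bool) \<Rightarrow> real" and H :: "nat \<Rightarrow> (nat \<Rightarrow> 'a \<times> bool) \<Rightarrow> real"
  assumes D: "integrable L D" "block_functional D"
    and H_meas[measurable]: "\<And>n. H n \<in> borel_measurable path_space"
    and H_0: "\<And>z. H 0 z = 0"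
    and H_rec: "\<And>n z. n \<ge> 1 \<Longrightarrow> inf_regen z \<Longrightarrow> H n z = D z + H (n - cycle_len z) (path_shift (cycle_len z) z)"
begin

lemma sum_cycle_is:
  assumes "inf_regen z"
  shows "(\<Sum>j\<in>{1..<n}. (if cycle_is j z then 1 else 0) * g j) =
    (if cycle_len z < n then g (cycle_len z) else 0 :: real)"
proof -
  have ex: "\<exists>i. snd (z i)" using inf_regenD[OF assms] by blast
  have "(\<Sum>j\<in>{1..<n}. (if cycle_is j z then 1 else 0) * g j) = (\<Sum>j\<in>{1..<n}. if j = cycle_len z then g j else 0)"
    using cycle_is_iff[OF ex] by (intro sum.cong) auto
  also have "\<dots> = (if cycle_len z < n then g (cycle_len z) else 0)"
    using first_regen_cases(1)[OF ex] by (subst sum.delta) auto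
  finally show ?thesis .
qed

text \<open>The random shift in \<open>H_rec\<close> is unfolded into a finite sum over possible
  cycle lengths; cycles of length at least \<open>n\<close> drop out by \<open>H_0\<close>. At most
  one indicator is non-zero, so squaring the sum produces no products of different
  \<open>j\<close>.\<close>

lemma cycle_expansion:
  assumes z: "inf_regen z" and n: "n \<ge> 1"
  shows "H n z = D z + (\<Sum>j\<in>{1..<n}. (if cycle_is j z then 1 else 0) * H (n - j) (path_shift j z))"
    and "(H n z)\<^sup>2 = (D z)\<^sup>2 + (\<Sum>j\<in>{1..<n}. 2 * (D z * (if cycle_is j z then 1 else 0) * H (n - j) (path_shift j z)))
      + (\<Sum>j\<in>{1..<n}. (if cycle_is j z then 1 else 0) * (H (n - j) (path_shift j z))\<^sup>2)"
proof -
  show 1: "H n z = D z + (\<Sum>j\<in>{1..<n}. (if cycle_is j z then 1 else 0) * H (n - j) (path_shift j z))"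
    unfolding H_rec[OF n z] sum_cycle_is[OF z] by (auto simp: H_0)
  have "(\<Sum>j\<in>{1..<n}. 2 * (D z * (if cycle_is j z then 1 else 0) * H (n - j) (path_shift j z)))
      = 2 * D z * (\<Sum>j\<in>{1..<n}. (if cycle_is j z then 1 else 0) * H (n - j) (path_shift j z))"
    by (simp add: sum_distrib_left mult.assoc)
  then show "(H n z)\<^sup>2 = (D z)\<^sup>2 + (\<Sum>j\<in>{1..<n}. 2 * (D z * (if cycle_is j z then 1 else 0) * H (n - j) (path_shift j z)))
      + (\<Sum>j\<in>{1..<n}. (if cycle_is j z then 1 else 0) * (H (n - j) (path_shift j z))\<^sup>2)"
    unfolding 1 sum_cycle_is[OF z] by (simp add: power2_eq_square algebra_simps)
qed

text \<open>Almost surely \<open>H n\<close> equals the finite expansion over the first cycle, whose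
  summands are integrable and factorize by the induction hypothesis for smaller arguments.\<close>

lemma integrable_renewal: "integrable L (H n)"
  and renewal_eq_integral_aux:
    "n \<ge> 1 \<Longrightarrow> (\<integral>z. H n z \<partial>L) = (\<integral>z. D z \<partial>L) + (\<Sum>j\<in>{1..<n}. cycle_pmf j * (\<integral>z. H (n - j) z \<partial>L))"
proof (induction n rule: less_induct)
  case (less n)
  let ?R = "\<lambda>z. D z + (\<Sum>j\<in>{1..<n}. (if cycle_is j z then 1 else 0) * H (n - j) (path_shift j z))"
  have IH: "integrable L (H (n - j))" if "j \<in> {1..<n}" for j
    using that by (intro less.IH) auto
  have int: "integrable L (\<lambda>z. (if cycle_is j z then 1 else 0) * H (n - j) (path_shift j z))"
    and eq: "(\<integral>z. (if cycle_is j z then 1 else 0) * H (n - j) (path_shift j z) \<partial>L)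
      = cycle_pmf j * (\<integral>z. H (n - j) z \<partial>L)" if "j \<in> {1..<n}" for j
    using first_cycle_integral[OF _ block_functional_1 IH[OF that], of j] that
    by (auto simp: cycle_pmf_def)
  have intR: "integrable L ?R"
    by (intro Bochner_Integration.integrable_add Bochner_Integration.integrable_sum D int)
  { case 1
    show ?case
    proof (cases "n \<ge> 1")
      case True
      have "AE z in L. ?R z = H n z"
        using AE_inf_regen by eventually_elim (rule cycle_expansion(1)[OF _ True, symmetric])
      then show ?thesis using intR by (subst integrable_cong_AE[symmetric]) auto
    next
      case False
      then have "H n = (\<lambda>_. 0)" using H_0 by (auto simp: not_le)
      then show ?thesis by simp
    qed
  next
    case 2
    have "AE z in L. H n z = ?R z"
      using AE_inf_regen by eventually_elim (rule cycle_expansion(1)[OF _ 2])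
    then have "(\<integral>z. H n z \<partial>L) = (\<integral>z. ?R z \<partial>L)"
      using borel_measurable_integrable[OF intR] by (intro integral_cong_AE) auto
    also have "\<dots> = (\<integral>z. D z \<partial>L) + (\<Sum>j\<in>{1..<n}. cycle_pmf j * (\<integral>z. H (n - j) z \<partial>L))"
      by (simp only: Bochner_Integration.integral_add Bochner_Integration.integral_sum D
        Bochner_Integration.integrable_sum int eq cong: sum.cong)
    finally show ?case . }
qed

lemma renewal_eq_integral: "renewal_eq cycle_pmf (\<integral>z. D z \<partial>L) (\<lambda>n. \<integral>z. H n z \<partial>L)"
  unfolding renewal_eq_def using renewal_eq_integral_aux by (auto simp: H_0[abs_def])

text \<open>The new ingredient is the cross term. There the block functional is \<open>D\<close>
  itself, so its integral separates into a first-block factor and the mean of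
  \<open>H (n - j)\<close>.\<close>

lemma integrable_renewal_square:
    "integrable L (\<lambda>z. (D z)\<^sup>2) \<Longrightarrow> integrable L (\<lambda>z. (H n z)\<^sup>2)"
  and renewal_square_aux:
    "integrable L (\<lambda>z. (D z)\<^sup>2) \<Longrightarrow> n \<ge> 1 \<Longrightarrow> (\<integral>z. (H n z)\<^sup>2 \<partial>L) = (\<integral>z. (D z)\<^sup>2 \<partial>L)
      + (\<Sum>j\<in>{1..<n}. 2 * ((\<integral>z. D z * (if cycle_is j z then 1 else 0) \<partial>L) * (\<integral>z. H (n - j) z \<partial>L)))
      + (\<Sum>j\<in>{1..<n}. cycle_pmf j * (\<integral>z. (H (n - j) z)\<^sup>2 \<partial>L))"
proof (induction n rule: less_induct)
  case (less n)
  let ?C = "\<lambda>j z. 2 * (D z * (if cycle_is j z then 1 else 0) * H (n - j) (path_shift j z))"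
  let ?S = "\<lambda>j z. (if cycle_is j z then 1 else 0) * (H (n - j) (path_shift j z))\<^sup>2"
  let ?R = "\<lambda>z. (D z)\<^sup>2 + (\<Sum>j\<in>{1..<n}. ?C j z) + (\<Sum>j\<in>{1..<n}. ?S j z)"
  { assume D2: "integrable L (\<lambda>z. (D z)\<^sup>2)"
    have IH: "integrable L (\<lambda>z. (H (n - j) z)\<^sup>2)" if "j \<in> {1..<n}" for j
      using that by (intro less.IH D2) auto
    have int: "integrable L (?S j)"
      and eq: "(\<integral>z. ?S j z \<partial>L) = cycle_pmf j * (\<integral>z. (H (n - j) z)\<^sup>2 \<partial>L)" if "j \<in> {1..<n}" for j
      using first_cycle_integral[OF _ block_functional_1 IH[OF that], of j] that
      by (auto simp: cycle_pmf_def)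
    have intC: "integrable L (?C j)"
      and eqC: "(\<integral>z. ?C j z \<partial>L) = 2 * ((\<integral>z. D z * (if cycle_is j z then 1 else 0) \<partial>L) * (\<integral>z. H (n - j) z \<partial>L))"
      if "j \<in> {1..<n}" for j
      using first_cycle_integral[OF D integrable_renewal, of j "n - j"] that by auto
    have intR: "integrable L ?R"
      by (intro Bochner_Integration.integrable_add Bochner_Integration.integrable_sum D2 int intC)
    have "(\<integral>z. ?R z \<partial>L) = (\<integral>z. (D z)\<^sup>2 \<partial>L) + (\<integral>z. (\<Sum>j\<in>{1..<n}. ?C j z) \<partial>L) + (\<integral>z. (\<Sum>j\<in>{1..<n}. ?S j z) \<partial>L)"
      by (simp only: Bochner_Integration.integral_add D2 Bochner_Integration.integrable_add
        Bochner_Integration.integrable_sum int intC)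
    also have "(\<integral>z. (\<Sum>j\<in>{1..<n}. ?C j z) \<partial>L) = (\<Sum>j\<in>{1..<n}. \<integral>z. ?C j z \<partial>L)"
      by (rule Bochner_Integration.integral_sum) (rule intC)
    also have "\<dots> = (\<Sum>j\<in>{1..<n}. 2 * ((\<integral>z. D z * (if cycle_is j z then 1 else 0) \<partial>L) * (\<integral>z. H (n - j) z \<partial>L)))"
      by (intro sum.cong refl eqC)
    also have "(\<integral>z. (\<Sum>j\<in>{1..<n}. ?S j z) \<partial>L) = (\<Sum>j\<in>{1..<n}. \<integral>z. ?S j z \<partial>L)"
      by (rule Bochner_Integration.integral_sum) (rule int)
    also have "\<dots> = (\<Sum>j\<in>{1..<n}. cycle_pmf j * (\<integral>z. (H (n - j) z)\<^sup>2 \<partial>L))"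
      by (intro sum.cong refl eq)
    finally have eqR: "(\<integral>z. ?R z \<partial>L) = (\<integral>z. (D z)\<^sup>2 \<partial>L)
      + (\<Sum>j\<in>{1..<n}. 2 * ((\<integral>z. D z * (if cycle_is j z then 1 else 0) \<partial>L) * (\<integral>z. H (n - j) z \<partial>L)))
      + (\<Sum>j\<in>{1..<n}. cycle_pmf j * (\<integral>z. (H (n - j) z)\<^sup>2 \<partial>L))" .
    note intR eqR }
  note R = this
  { case 1
    show ?case
    proof (cases "n \<ge> 1")
      case True
      have "AE z in L. ?R z = (H n z)\<^sup>2"
        using AE_inf_regen by eventually_elim (rule cycle_expansion(2)[OF _ True, symmetric])
      then show ?thesis using R(1)[OF 1] by (subst integrable_cong_AE[symmetric]) auto
    next
      case False
      then have "H n = (\<lambda>_. 0)" using H_0 by (auto simp: not_le)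
      then show ?thesis by simp
    qed
  next
    case 2
    have "AE z in L. (H n z)\<^sup>2 = ?R z"
      using AE_inf_regen by eventually_elim (rule cycle_expansion(2)[OF _ 2(2)])
    then have "(\<integral>z. (H n z)\<^sup>2 \<partial>L) = (\<integral>z. ?R z \<partial>L)"
      using borel_measurable_integrable[OF R(1)[OF 2(1)]] by (intro integral_cong_AE) auto
    with R(2)[OF 2(1)] show ?case by simp }
qed

text \<open>With mean-zero increments the renewal equation gives every \<open>H n\<close> mean zero,
  which kills the cross terms and leaves a renewal equation for the second moments.\<close>

lemma renewal_eq_integral_square:
  assumes "integrable L (\<lambda>z. (D z)\<^sup>2)" "(\<integral>z. D z \<partial>L) = 0"
  shows "renewal_eq cycle_pmf (\<integral>z. (D z)\<^sup>2 \<partial>L) (\<lambda>n. \<integral>z. (H n z)\<^sup>2 \<partial>L)"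
proof -
  have "(\<integral>z. H n z \<partial>L) = 0" for n
  proof (induction n rule: less_induct)
    case (less n)
    show ?case
    proof (cases "n \<ge> 1")
      case True
      then show ?thesis
        using renewal_eq_integral_aux[OF True] assms(2) less.IH by (auto intro!: sum.neutral)
    qed (auto simp: H_0[abs_def] not_le)
  qed
  then show ?thesis
    unfolding renewal_eq_def using renewal_square_aux[OF assms(1)] by (auto simp: H_0[abs_def])
qed

end

end

section \<open>Moments of epochs and of centred sums up to an epoch\<close>

lemma sum_lessThan_add: "(\<Sum>i<k + l. g i) = (\<Sum>i<k. g i) + (\<Sum>i<l. g (k + i))"
  for g :: "nat \<Rightarrow> 'b::comm_monoid_add"
  by (induction l) (auto simp: add.assoc)

text \<open>Indices up to \<open>t\<close> all contribute \<open>g 0 = 0\<close>, and the remaining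
  ones are translated by \<open>t\<close>.\<close>

lemma sum_truncated_shift:
  fixes g :: "nat \<Rightarrow> real"
  assumes "g 0 = 0"
  shows "(\<Sum>i\<in>{1..n}. g (i - t)) = (\<Sum>k\<le>n - t. g k)"
proof (induction n)
  case (Suc n)
  then show ?case
    using assms by (cases "t \<le> n") (auto simp: Suc_diff_le)
qed (simp add: assms)

abbreviation epoch :: "nat \<Rightarrow> (nat \<Rightarrow> 'a \<times> bool) \<Rightarrow> nat" where
  "epoch n z \<equiv> next_regen n (\<lambda>i. snd (z i))"

lemma epoch_rec:
  assumes "inf_regen z" "n \<ge> 1"
  shows "epoch n z = cycle_len z + epoch (n - cycle_len z) (path_shift (cycle_len z) z)"
  using next_regen_shift[OF inf_regenD[OF assms(1)] assms(2)] by (simp add: path_shift_def)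

lemma cycle_len_comb_seq:
  assumes "j \<ge> 1" "cycle_is j z"
  shows "cycle_len (comb_seq j z z') = j" "cycle_len z = j"
  using assms by (simp_all add: cycle_is_imp_cycle cycle_is_comb_seq)

lemma block_functional_cycle_len: "block_functional (\<lambda>z. h (cycle_len z))"
  unfolding block_functional_def
proof (intro allI impI)
  fix j :: nat and z z' :: "nat \<Rightarrow> 'b \<times> bool" assume "j \<ge> 1" "cycle_is j z"
  then show "h (cycle_len (comb_seq j z z')) = h (cycle_len z)"
    by (simp only: cycle_len_comb_seq)
qed

lemma block_functional_block_sum:
  "block_functional (\<lambda>z. \<Sum>i<cycle_len z. \<phi> (fst (z i)))"
  unfolding block_functional_def
proof (intro allI impI)
  fix j :: nat and z z' :: "nat \<Rightarrow> 'a \<times> bool" assume "j \<ge> 1" "cycle_is j z"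
  then show "(\<Sum>i<cycle_len (comb_seq j z z'). \<phi> (fst (comb_seq j z z' i))) = (\<Sum>i<cycle_len z. \<phi> (fst (z i)))"
    by (simp only: cycle_len_comb_seq) (simp add: comb_seq_def)
qed

lemma measurable_random_sum:
  fixes g :: "nat \<Rightarrow> 'b \<Rightarrow> real"
  assumes [measurable]: "\<And>i. g i \<in> borel_measurable N" "T \<in> N \<rightarrow>\<^sub>M count_space UNIV"
  shows "(\<lambda>z. \<Sum>i<T z. g i z) \<in> borel_measurable N"
  by (rule measurable_compose_countable[of "\<lambda>k z. \<Sum>i<k. g i z"]) auto

context regenerative
begin

context
  assumes square_integrable_cycle: "integrable L (\<lambda>z. (real (cycle_len z))\<^sup>2)"
begin

lemma integrable_cycle: "integrable L (\<lambda>z. real (cycle_len z))"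
  by (rule Bochner_Integration.integrable_bound[OF square_integrable_cycle])
    (auto intro!: AE_I2 simp: power2_eq_square of_nat_mult[symmetric] simp del: of_nat_mult)

text \<open>A cycle takes at least one step. The resulting positivity is what later permits division
  by the mean cycle length.\<close>

lemma expectation_cycle_ge_1: "1 \<le> (\<integral>z. real (cycle_len z) \<partial>L)"
proof -
  have "(\<integral>z. 1 \<partial>L) \<le> (\<integral>z. real (cycle_len z) \<partial>L)"
  proof (intro integral_mono_AE integrable_cycle)
    show "AE z in L. 1 \<le> real (cycle_len z)"
      using AE_ex_regen
    proof eventually_elim
      case (elim z)
      then show ?case using first_regen_cases(1)[of "\<lambda>i. snd (z i)"] by simp
    qed
  qed simp
  then show ?thesis by (simp add: prob_space)
qed

lemma square_integrable_epoch: "integrable L (\<lambda>z. (real (epoch n z))\<^sup>2)"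
  by (rule integrable_renewal_square[OF integrable_cycle block_functional_cycle_len _ _ _ square_integrable_cycle])
    (auto simp: next_regen_0 epoch_rec)

lemma integrable_epoch: "integrable L (\<lambda>z. real (epoch n z))"
  by (rule integrable_renewal[OF integrable_cycle block_functional_cycle_len])
    (auto simp: next_regen_0 epoch_rec)

lemma renewal_eq_epoch:
  "renewal_eq cycle_pmf (\<integral>z. real (cycle_len z) \<partial>L) (\<lambda>n. \<integral>z. real (epoch n z) \<partial>L)"
  by (rule renewal_eq_integral[OF integrable_cycle block_functional_cycle_len])
    (auto simp: next_regen_0 epoch_rec)

lemma expectation_epoch_le:
  assumes n: "n \<ge> 1"
  shows "(\<integral>z. real (epoch n z) \<partial>L) \<le>
    real n + ((\<integral>z. (real (cycle_len z))\<^sup>2 \<partial>L) / (\<integral>z. real (cycle_len z) \<partial>L) - 1)"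
proof -
  define a where "a = (\<lambda>n. \<integral>z. real (epoch n z) \<partial>L)"
  define m where "m = (\<integral>z. real (cycle_len z) \<partial>L)"
  define q where "q = (\<integral>z. (real (epoch n z))\<^sup>2 \<partial>L)"
  define D where "D = (\<lambda>z :: nat \<Rightarrow> 'a \<times> bool. (real (cycle_len z))\<^sup>2 - real (cycle_len z))"
  \<comment> \<open>On a path with infinitely many regenerations this is twice the sum of the
    waiting times \<open>epoch i z - i\<close> over \<open>i\<close> from \<open>1\<close> to
    \<open>epoch n z\<close>, written with indices up to \<open>n\<close> only because
    \<open>epoch\<close> is constant from \<open>n\<close> to \<open>epoch n z\<close>. One block of
    length t contributes 2(0 + 1 + ... + (t - 1)) = t(t - 1), which is \<open>D\<close>.\<close>
  define H where "H = (\<lambda>n (z :: nat \<Rightarrow> 'a \<times> bool).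
    2 * (\<Sum>i\<le>n. real (epoch i z)) + (real (epoch n z))\<^sup>2 - (2 * real n + 1) * real (epoch n z))"
  have m: "1 \<le> m" unfolding m_def by (rule expectation_cycle_ge_1)
  have D: "integrable L D" "(\<integral>z. D z \<partial>L) = (\<integral>z. (real (cycle_len z))\<^sup>2 \<partial>L) - m"
    using square_integrable_cycle integrable_cycle by (auto simp: D_def m_def)
  have "block_functional D"
    unfolding D_def by (rule block_functional_cycle_len)
  moreover have "H k \<in> borel_measurable path_space" for k
    unfolding H_def by measurable
  moreover have "H 0 z = 0" for z by (simp add: H_def next_regen_0)
  moreover have "H k z = D z + H (k - cycle_len z) (path_shift (cycle_len z) z)"
    if "k \<ge> 1" and z: "inf_regen z" for k z
  proof -
    define t where "t = cycle_len z"
    define g where "g = (\<lambda>i. real (epoch i (path_shift t z)))"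
    have rec: "real (epoch i z) = real t + g (i - t)" if "i \<ge> 1" for i
      using epoch_rec[OF z that] by (simp add: t_def g_def)
    have g: "real (epoch i (path_shift t z)) = g i" for i by (simp add: g_def)
    have g0: "g 0 = 0" by (simp add: g_def next_regen_0)
    have "(\<Sum>i\<le>k. real (epoch i z)) = (\<Sum>i\<in>{1..k}. real (epoch i z))"
      by (intro sum.mono_neutral_right) (auto simp: next_regen_0 not_le)
    also have "\<dots> = (\<Sum>i\<in>{1..k}. real t + g (i - t))"
      by (intro sum.cong) (auto simp: rec)
    also have "\<dots> = real k * real t + (\<Sum>i\<le>k - t. g i)"
      unfolding sum.distrib sum_truncated_shift[of g, OF g0] by simp
    finally have sum: "(\<Sum>i\<le>k. real (epoch i z)) = real k * real t + (\<Sum>i\<le>k - t. g i)" .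
    \<comment> \<open>If \<open>k < t\<close>, truncated and real subtraction differ, but both sides
      vanish because \<open>g 0 = 0\<close>.\<close>
    have "real (k - t) * g (k - t) = (real k - real t) * g (k - t)"
      using g0 by (cases "t \<le> k") (auto simp: of_nat_diff)
    then show ?thesis
      unfolding H_def D_def sum rec[OF that(1)] t_def[symmetric] g
      by (simp add: power2_eq_square algebra_simps)
  qed
  ultimately have "renewal_eq cycle_pmf (\<integral>z. D z \<partial>L) (\<lambda>n. \<integral>z. H n z \<partial>L)"
    using D(1) by (intro renewal_eq_integral) auto
  from renewal_eq_proportional[OF this renewal_eq_epoch, of n]
  have "m * (\<integral>z. H n z \<partial>L) = ((\<integral>z. (real (cycle_len z))\<^sup>2 \<partial>L) - m) * a n"
    unfolding D(2) a_def m_def by simp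
  then have "(\<integral>z. H n z \<partial>L) = ((\<integral>z. (real (cycle_len z))\<^sup>2 \<partial>L) / m - 1) * a n"
    using m by (simp add: field_simps)
  moreover have "(\<integral>z. H n z \<partial>L) = 2 * (\<Sum>i\<le>n. a i) + q - (2 * real n + 1) * a n"
    unfolding H_def a_def q_def using integrable_epoch square_integrable_epoch
    by (simp add: Bochner_Integration.integral_sum)
  moreover have "(a n)\<^sup>2 \<le> q"
    using variance_eq[OF integrable_epoch square_integrable_epoch, of n]
      variance_positive[of "\<lambda>z. real (epoch n z)"] by (simp add: a_def q_def)
  ultimately show ?thesis
    using lorden[OF cycle_pmf_nonneg _ renewal_eq_epoch sum_cycle_pmf_le_1 _ n, of q
        "(\<integral>z. (real (cycle_len z))\<^sup>2 \<partial>L) / m - 1"] m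
    by (simp add: a_def m_def)
qed

text \<open>The second moment of the sum and the mean epoch solve the same renewal equation with
  forcing terms E \<Xi>^2 and E \<tau>, so they are proportional. The number of blocks never has to
  be treated as a stopping time.\<close>

lemma wald_second_moment:
  fixes \<phi> :: "'a \<Rightarrow> real"
  defines "\<Xi> \<equiv> \<lambda>z. \<Sum>i<cycle_len z. \<phi> (fst (z i))"
  assumes [measurable]: "\<phi> \<in> borel_measurable borel"
    and int: "integrable L \<Xi>" "integrable L (\<lambda>z. (\<Xi> z)\<^sup>2)" and mean: "(\<integral>z. \<Xi> z \<partial>L) = 0"
  shows "integrable L (\<lambda>z. (\<Sum>i<epoch n z. \<phi> (fst (z i)))\<^sup>2)"
    and "(\<integral>z. (\<Sum>i<epoch n z. \<phi> (fst (z i)))\<^sup>2 \<partial>L) =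
      (\<integral>z. (\<Xi> z)\<^sup>2 \<partial>L) / (\<integral>z. real (cycle_len z) \<partial>L) * (\<integral>z. real (epoch n z) \<partial>L)"
proof -
  define H where "H = (\<lambda>n (z :: nat \<Rightarrow> 'a \<times> bool). \<Sum>i<epoch n z. \<phi> (fst (z i)))"
  have H_meas: "H k \<in> borel_measurable path_space" for k
    unfolding H_def by (rule measurable_random_sum) measurable
  have H_0: "H 0 z = 0" for z by (simp add: H_def next_regen_0)
  have H_rec: "H k z = \<Xi> z + H (k - cycle_len z) (path_shift (cycle_len z) z)"
    if "k \<ge> 1" "inf_regen z" for k z
    unfolding H_def \<Xi>_def epoch_rec[OF that(2,1)] sum_lessThan_add by (simp add: path_shift_def)
  have block: "block_functional \<Xi>"
    unfolding \<Xi>_def by (rule block_functional_block_sum)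
  show "integrable L (\<lambda>z. (\<Sum>i<epoch n z. \<phi> (fst (z i)))\<^sup>2)"
    using integrable_renewal_square[OF int(1) block H_meas H_0 H_rec int(2)] unfolding H_def .
  have "renewal_eq cycle_pmf (\<integral>z. (\<Xi> z)\<^sup>2 \<partial>L) (\<lambda>n. \<integral>z. (H n z)\<^sup>2 \<partial>L)"
    by (rule renewal_eq_integral_square[OF int(1) block H_meas H_0 H_rec int(2) mean])
  from renewal_eq_proportional[OF this renewal_eq_epoch, of n] expectation_cycle_ge_1
  show "(\<integral>z. (\<Sum>i<epoch n z. \<phi> (fst (z i)))\<^sup>2 \<partial>L) =
      (\<integral>z. (\<Xi> z)\<^sup>2 \<partial>L) / (\<integral>z. real (cycle_len z) \<partial>L) * (\<integral>z. real (epoch n z) \<partial>L)"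
    unfolding H_def by (simp add: field_simps)
qed

end

end

section \<open>The path law of a split chain\<close>

definition cylinder :: "('a set \<times> bool) list \<Rightarrow> (nat \<Rightarrow> 'a \<times> bool) set" where
  "cylinder L = {z. \<forall>i<length L. fst (z i) \<in> fst (L ! i) \<and> snd (z i) = snd (L ! i)}"

definition borel_list :: "('a::topological_space set \<times> bool) list \<Rightarrow> bool" where
  "borel_list L \<longleftrightarrow> (\<forall>i<length L. fst (L ! i) \<in> sets borel)"

lemma space_path_space: "space path_space = UNIV"
  by (simp add: space_PiM space_pair_measure)

lemma sets_cylinder:
  assumes "borel_list L"
  shows "cylinder L \<in> sets path_space"
proof -
  have "{z \<in> space path_space. \<forall>i\<in>{..<length L}. fst (z i) \<in> fst (L ! i) \<and> snd (z i) = snd (L ! i)}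
      \<in> sets path_space"
  proof (rule sets.sets_Collect_finite_All)
    fix i assume "i \<in> {..<length L}"
    then have [measurable]: "fst (L ! i) \<in> sets borel" using assms by (simp add: borel_list_def)
    show "{z \<in> space path_space. fst (z i) \<in> fst (L ! i) \<and> snd (z i) = snd (L ! i)} \<in> sets path_space"
      by measurable
  qed simp
  then show ?thesis by (simp add: cylinder_def space_path_space Ball_def)
qed

text \<open>Finite-dimensional product sets determine a path law, and each is a finite disjoint
  union of cylinders. Restricting to lists of length at least \<open>k\<close> lets the regeneration
  proof assume that coordinate \<open>m\<close> is constrained.\<close>

lemma path_measure_eqI:
  assumes sets: "sets N1 = sets path_space" "sets N2 = sets path_space" and fin: "finite_measure N1"
    and eq: "\<And>L. length L \<ge> k \<Longrightarrow> borel_list L \<Longrightarrow> emeasure N1 (cylinder L) = emeasure N2 (cylinder L)"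
  shows "N1 = N2"
proof (rule measure_eqI_PiM_infinite[OF sets _ fin])
  fix A :: "nat \<Rightarrow> ('a \<times> bool) set" and J :: "nat set"
  assume J: "finite J" and A: "\<And>i. i \<in> J \<Longrightarrow> A i \<in> sets (borel \<Otimes>\<^sub>M count_space UNIV)"
  obtain n0 where n0: "J \<subseteq> {..<n0}" using finite_nat_iff_bounded J by blast
  define n where "n = max k n0"
  define A' where "A' = (\<lambda>i. if i \<in> J then A i else UNIV)"
  define G where "G = {gs :: bool list. length gs = n}"
  \<comment> \<open>A cylinder prescribes every flag, so the product set is cut along all flag
    strings of length \<open>n\<close>; at each coordinate the state component is the slice of
    \<open>A' i\<close> at that flag.\<close>
  define C where "C = (\<lambda>gs. map (\<lambda>i. ({x. (x, gs ! i) \<in> A' i}, gs ! i)) [0..<n])"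
  have "UNIV \<in> sets ((borel :: 'a measure) \<Otimes>\<^sub>M (count_space UNIV :: bool measure))"
    using sets.top[of "(borel :: 'a measure) \<Otimes>\<^sub>M (count_space UNIV :: bool measure)"]
    by (simp add: space_pair_measure)
  then have A': "A' i \<in> sets (borel \<Otimes>\<^sub>M count_space UNIV)" for i
    using A by (simp add: A'_def)
  have "{x. (x, g) \<in> A' i} \<in> sets borel" for g i
    using sets_Pair2[OF A'[of i], of g] by (simp add: vimage_def)
  then have C: "borel_list (C gs)" "length (C gs) \<ge> k" for gs
    by (auto simp: borel_list_def C_def n_def)
  have fin_G: "finite G"
    using finite_lists_length_eq[of "UNIV :: bool set" n] by (simp add: G_def)
  have mem_C: "z \<in> cylinder (C gs) \<longleftrightarrow> (\<forall>i<n. z i \<in> A' i \<and> snd (z i) = gs ! i)" for z gs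
  proof -
    have "(fst y, g) \<in> B \<and> snd y = g \<longleftrightarrow> y \<in> B \<and> snd y = g" for y g and B :: "('a \<times> bool) set"
      by (cases y) auto
    then show ?thesis by (simp add: cylinder_def C_def)
  qed
  have disj: "disjoint_family_on (\<lambda>gs. cylinder (C gs)) G"
    unfolding disjoint_family_on_def
  proof (intro ballI impI)
    fix gs hs assume "gs \<in> G" "hs \<in> G" "gs \<noteq> hs"
    then obtain i where "i < n" "gs ! i \<noteq> hs ! i" by (auto simp: G_def list_eq_iff_nth_eq)
    then show "cylinder (C gs) \<inter> cylinder (C hs) = {}" by (auto simp: mem_C)
  qed
  have "prod_emb UNIV (\<lambda>_. borel \<Otimes>\<^sub>M count_space UNIV) J (Pi\<^sub>E J A) = {z. \<forall>i<n. z i \<in> A' i}"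
  proof -
    have "i < n" if "i \<in> J" for i using that n0 by (auto simp: n_def)
    then show ?thesis
      by (auto simp: prod_emb_def space_pair_measure space_PiM A'_def PiE_iff restrict_def extensional_def)
  qed
  also have "\<dots> = (\<Union>gs\<in>G. cylinder (C gs))"
  proof safe
    fix z assume z: "\<forall>i<n. z i \<in> A' i"
    have "z \<in> cylinder (C (map (\<lambda>i. snd (z i)) [0..<n]))" using z by (simp add: mem_C)
    then show "z \<in> (\<Union>gs\<in>G. cylinder (C gs))" by (rule UN_I[rotated]) (simp add: G_def)
  qed (auto simp: mem_C)
  finally have *: "prod_emb UNIV (\<lambda>_. borel \<Otimes>\<^sub>M count_space UNIV) J (Pi\<^sub>E J A) = (\<Union>gs\<in>G. cylinder (C gs))" .
  have "emeasure N (\<Union>gs\<in>G. cylinder (C gs)) = (\<Sum>gs\<in>G. emeasure N (cylinder (C gs)))"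
    if "sets N = sets path_space" for N
    using sets_cylinder[OF C(1)] that by (intro sum_emeasure[symmetric] disj fin_G) auto
  then show "emeasure N1 (prod_emb UNIV (\<lambda>_. borel \<Otimes>\<^sub>M count_space UNIV) J (Pi\<^sub>E J A)) =
      emeasure N2 (prod_emb UNIV (\<lambda>_. borel \<Otimes>\<^sub>M count_space UNIV) J (Pi\<^sub>E J A))"
    unfolding * using sets eq[OF C(2,1)] by simp
qed

text \<open>After a flag \<open>True\<close> the next state is drawn from \<nu> whatever the present
  state is. The future thus enters as a constant factor, which passes through the earlier steps by
  linearity of the integrals.\<close>

lemma split_cyl_regen:
  assumes "prob_space \<nu>"
  shows "split_cyl P \<beta> J \<nu> (L1 @ (A, True) # L2) x =
    split_cyl P \<beta> J \<nu> (L1 @ [(A, True)]) x * (\<integral>y. split_cyl P \<beta> J \<nu> L2 y \<partial>\<nu>)"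
proof (induction L1 arbitrary: x)
  case Nil
  show ?case using prob_space.prob_space[OF assms] by simp
next
  case (Cons c L1)
  show ?case unfolding append_Cons split_cyl.simps Q_int_def Cons.IH
    by (simp add: algebra_simps diff_divide_distrib)
qed

definition path_law :: "'w measure \<Rightarrow> (nat \<Rightarrow> 'w \<Rightarrow> 'a::topological_space) \<Rightarrow> (nat \<Rightarrow> 'w \<Rightarrow> bool)
    \<Rightarrow> (nat \<Rightarrow> 'a \<times> bool) measure" where
  "path_law M X \<Gamma> = distr M path_space (\<lambda>w i. (X i w, \<Gamma> i w))"

lemma sets_path_law[measurable_cong]: "sets (path_law M X \<Gamma>) = sets path_space"
  by (simp add: path_law_def)

context
  fixes M :: "'w measure" and X :: "nat \<Rightarrow> 'w \<Rightarrow> 'a::topological_space" and \<Gamma> P \<beta> J \<nu>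
  assumes chain: "split_chain M X \<Gamma> P \<beta> J \<nu>" and \<nu>: "prob_space \<nu>"
begin

lemma measurable_path: "(\<lambda>w i. (X i w, \<Gamma> i w)) \<in> M \<rightarrow>\<^sub>M path_space"
proof -
  have [measurable]: "X i \<in> M \<rightarrow>\<^sub>M borel" "\<Gamma> i \<in> M \<rightarrow>\<^sub>M count_space UNIV" for i
    using chain by (auto simp: split_chain_def)
  show ?thesis by (rule measurable_PiM_single') (auto simp: space_pair_measure)
qed

lemma prob_space_path_law: "prob_space (path_law M X \<Gamma>)"
  unfolding path_law_def using chain measurable_path
  by (intro prob_space.prob_space_distr) (auto simp: split_chain_def)

lemma measure_path_law_cylinder:
  assumes "borel_list L"
  shows "measure (path_law M X \<Gamma>) (cylinder L) = (\<integral>x. split_cyl P \<beta> J \<nu> L x \<partial>\<nu>)"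
proof -
  have "measure (path_law M X \<Gamma>) (cylinder L)
      = measure M ((\<lambda>w i. (X i w, \<Gamma> i w)) -` cylinder L \<inter> space M)"
    unfolding path_law_def by (rule measure_distr[OF measurable_path sets_cylinder[OF assms]])
  also have "(\<lambda>w i. (X i w, \<Gamma> i w)) -` cylinder L \<inter> space M =
      {w \<in> space M. \<forall>i<length L. X i w \<in> fst (L ! i) \<and> \<Gamma> i w = snd (L ! i)}"
    by (auto simp: cylinder_def)
  finally show ?thesis
    using chain assms unfolding split_chain_def borel_list_def by simp
qed

text \<open>Both measures are compared on cylinders long enough to fix flag \<open>m\<close>. If
  that flag is \<open>False\<close>, both sides are zero; if it is \<open>True\<close>,
  \<open>split_cyl_regen\<close> gives the factorization.\<close>

lemma path_law_regen:
  defines "Law \<equiv> path_law M X \<Gamma>"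
  shows "density Law (\<lambda>z. ennreal (if snd (z m) then 1 else 0)) =
      distr (density Law (\<lambda>z. ennreal (if snd (z m) then 1 else 0)) \<Otimes>\<^sub>M Law) path_space
        (\<lambda>(z, z'). comb_seq (Suc m) z z')"
proof -
  interpret Law: prob_space Law unfolding Law_def by (rule prob_space_path_law)
  have [measurable_cong]: "sets Law = sets path_space" by (simp add: Law_def sets_path_law)
  define N where "N = density Law (\<lambda>z. ennreal (if snd (z m) then 1 else 0))"
  have sets_N[measurable_cong]: "sets N = sets path_space"
    by (simp add: N_def Law_def sets_path_law)
  have emeasure_N: "emeasure N A = emeasure Law (A \<inter> {z. snd (z m)})" if "A \<in> sets path_space" for A
  proof -
    have [measurable]: "A \<in> sets path_space" by fact
    have "emeasure N A = (\<integral>\<^sup>+z. ennreal (if snd (z m) then 1 else 0) * indicator A z \<partial>Law)"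
      unfolding N_def by (rule emeasure_density) measurable
    also have "\<dots> = (\<integral>\<^sup>+z. indicator (A \<inter> {z \<in> space path_space. snd (z m)}) z \<partial>Law)"
      by (intro nn_integral_cong) (auto simp: space_path_space split: split_indicator)
    also have "\<dots> = emeasure Law (A \<inter> {z \<in> space path_space. snd (z m)})"
      by (rule nn_integral_indicator) measurable
    finally show ?thesis by (simp add: space_path_space)
  qed
  have N_cyl: "emeasure N (cylinder L) = (if snd (L ! m) then emeasure Law (cylinder L) else 0)"
    if "m < length L" "borel_list L" for L
  proof -
    have "cylinder L \<inter> {z. snd (z m)} = (if snd (L ! m) then cylinder L else {})"
      using that(1) by (auto simp: cylinder_def)
    then show ?thesis by (simp add: emeasure_N[OF sets_cylinder[OF that(2)]])
  qed
  have "emeasure N (space N) \<le> emeasure Law (space Law)"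
    using emeasure_N[of "space path_space"] sets_eq_imp_space_eq[OF sets_N]
    by (simp add: emeasure_space)
  then have fin: "finite_measure N"
    by (intro finite_measureI) (auto simp: Law.emeasure_space_1 top_unique)
  have "N = distr (N \<Otimes>\<^sub>M Law) path_space (\<lambda>(z, z'). comb_seq (Suc m) z z')"
  proof (rule path_measure_eqI[where k = "Suc m"])
    fix L :: "('a set \<times> bool) list" assume L: "Suc m \<le> length L" "borel_list L"
    \<comment> \<open>The list is cut just after coordinate \<open>m\<close>, where the two paths
      are glued, so that the preimage of the cylinder is a rectangle.\<close>
    define L1 where "L1 = take (Suc m) L"
    define L2 where "L2 = drop (Suc m) L"
    have bl: "borel_list L1" "borel_list L2" using L by (auto simp: borel_list_def L1_def L2_def)
    have L1: "m < length L1" "L1 ! m = L ! m" using L by (auto simp: L1_def)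
    have pre: "(\<lambda>(z, z'). comb_seq (Suc m) z z') -` cylinder L \<inter> space (N \<Otimes>\<^sub>M Law)
        = cylinder L1 \<times> cylinder L2"
    proof (intro set_eqI)
      fix p :: "(nat \<Rightarrow> 'a \<times> bool) \<times> (nat \<Rightarrow> 'a \<times> bool)"
      obtain z z' where p: "p = (z, z')" by (cases p)
      have sp: "space (N \<Otimes>\<^sub>M Law) = UNIV"
        using sets_eq_imp_space_eq[OF sets_N] by (simp add: space_pair_measure Law_def path_law_def space_path_space)
      define Q where "Q = (\<lambda>i y. fst y \<in> fst (L ! i) \<and> snd y = snd (L ! i))"
      have "comb_seq (Suc m) z z' \<in> cylinder L \<longleftrightarrow> (\<forall>i<length L. Q i (comb_seq (Suc m) z z' i))"
        by (simp add: cylinder_def Q_def)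
      also have "\<dots> \<longleftrightarrow> (\<forall>i<Suc m. Q i (z i)) \<and> (\<forall>i<length L - Suc m. Q (Suc m + i) (z' i))"
      proof safe
        fix i assume *: "\<forall>i<length L. Q i (comb_seq (Suc m) z z' i)"
        show "Q i (z i)" if "i < Suc m" using *[rule_format, of i] that L by (simp add: comb_seq_def)
        show "Q (Suc m + i) (z' i)" if "i < length L - Suc m"
          using *[rule_format, of "Suc m + i"] that L by (simp add: comb_seq_def)
      next
        fix i assume *: "\<forall>i<Suc m. Q i (z i)" "\<forall>i<length L - Suc m. Q (Suc m + i) (z' i)" "i < length L"
        show "Q i (comb_seq (Suc m) z z' i)"
        proof (cases "i < Suc m")
          case False
          then show ?thesis using *(2)[rule_format, of "i - Suc m"] *(3) by (simp add: comb_seq_def)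
        qed (use * in \<open>simp add: comb_seq_def\<close>)
      qed
      also have "\<dots> \<longleftrightarrow> z \<in> cylinder L1 \<and> z' \<in> cylinder L2"
        using L by (auto simp: cylinder_def L1_def L2_def Q_def)
      finally show "p \<in> (\<lambda>(z, z'). comb_seq (Suc m) z z') -` cylinder L \<inter> space (N \<Otimes>\<^sub>M Law)
          \<longleftrightarrow> p \<in> cylinder L1 \<times> cylinder L2"
        by (simp add: p sp)
    qed
    have "emeasure (distr (N \<Otimes>\<^sub>M Law) path_space (\<lambda>(z, z'). comb_seq (Suc m) z z')) (cylinder L)
        = emeasure (N \<Otimes>\<^sub>M Law) (cylinder L1 \<times> cylinder L2)"
      unfolding pre[symmetric] using sets_cylinder[OF L(2)] by (intro emeasure_distr) measurable
    also have "\<dots> = emeasure N (cylinder L1) * emeasure Law (cylinder L2)"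
      using sets_cylinder[OF bl(1)] sets_cylinder[OF bl(2)]
      by (intro Law.emeasure_pair_measure_Times) (auto simp: sets_N Law_def sets_path_law)
    also have "\<dots> = emeasure N (cylinder L)"
    proof (cases "snd (L ! m)")
      case False
      then show ?thesis using N_cyl[of L1] N_cyl[of L] L L1 bl by simp
    next
      case True
      define A where "A = fst (L ! m)"
      have Lm: "L ! m = (A, True)" using True by (auto simp: A_def prod_eq_iff)
      have L1_eq: "L1 = take m L @ [(A, True)]"
        using L Lm by (simp add: L1_def take_Suc_conv_app_nth)
      have L_eq: "L = take m L @ (A, True) # L2"
        using L Lm id_take_nth_drop[of m L] by (simp add: L2_def)
      have "measure Law (cylinder L) = (\<integral>x. split_cyl P \<beta> J \<nu> (take m L @ (A, True) # L2) x \<partial>\<nu>)"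
        unfolding L_eq[symmetric] Law_def by (rule measure_path_law_cylinder[OF L(2)])
      also have "\<dots> = (\<integral>x. split_cyl P \<beta> J \<nu> L1 x \<partial>\<nu>) * (\<integral>x. split_cyl P \<beta> J \<nu> L2 x \<partial>\<nu>)"
        unfolding split_cyl_regen[OF \<nu>, of _ _ _ "take m L"] L1_eq[symmetric] by simp
      also have "\<dots> = measure Law (cylinder L1) * measure Law (cylinder L2)"
        unfolding Law_def by (simp add: measure_path_law_cylinder bl)
      finally show ?thesis
        using N_cyl[of L1] N_cyl[of L] L L1 bl True
        by (simp add: Law.emeasure_eq_measure ennreal_mult[symmetric])
    qed
    finally show "emeasure N (cylinder L) =
        emeasure (distr (N \<Otimes>\<^sub>M Law) path_space (\<lambda>(z, z'). comb_seq (Suc m) z z')) (cylinder L)" ..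
  qed (simp_all add: sets_N fin)
  then show ?thesis unfolding N_def .
qed

end

section \<open>The residual kernel and the occupation identity\<close>

text \<open>A class of functions that are integrable under all the probability measures at hand and
  that is preserved by the kernel operators, so operator identities need no further integrability
  checks.\<close>

definition bounded_borel :: "('a::topological_space \<Rightarrow> real) \<Rightarrow> bool" where
  "bounded_borel g \<longleftrightarrow> g \<in> borel_measurable borel \<and> (\<exists>B. \<forall>x. \<bar>g x\<bar> \<le> B)"

lemma bounded_borelI:
  "g \<in> borel_measurable borel \<Longrightarrow> (\<And>x. \<bar>g x\<bar> \<le> B) \<Longrightarrow> bounded_borel g"
  by (auto simp: bounded_borel_def)

lemma bounded_borel_measurable: "bounded_borel g \<Longrightarrow> g \<in> borel_measurable borel"
  by (simp add: bounded_borel_def)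

lemma bounded_borel_integrable:
  assumes "bounded_borel g" "prob_space N" "sets N = sets borel"
  shows "integrable N g"
proof -
  interpret prob_space N by fact
  obtain B where "\<And>x. \<bar>g x\<bar> \<le> B" "g \<in> borel_measurable borel" using assms by (auto simp: bounded_borel_def)
  then show ?thesis
    by (intro integrable_const_bound[of _ B]) (auto simp: measurable_cong_sets[OF assms(3) refl])
qed

lemma bounded_borel_const: "bounded_borel (\<lambda>_. c)"
  by (rule bounded_borelI[of _ "\<bar>c\<bar>"]) auto

lemma bounded_borel_indicator: "A \<in> sets borel \<Longrightarrow> bounded_borel (indicator A)"
  by (rule bounded_borelI[of _ 1]) (auto split: split_indicator)

lemma bounded_borel_add:
  assumes "bounded_borel g" "bounded_borel h"
  shows "bounded_borel (\<lambda>x. g x + h x)"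
proof -
  obtain B C where "\<And>x. \<bar>g x\<bar> \<le> B" "\<And>x. \<bar>h x\<bar> \<le> C" using assms by (auto simp: bounded_borel_def)
  then have "\<bar>g x + h x\<bar> \<le> B + C" for x by (intro order.trans[OF abs_triangle_ineq] add_mono)
  then show ?thesis using assms by (intro bounded_borelI) (auto simp: bounded_borel_def)
qed

lemma bounded_borel_mult:
  assumes "bounded_borel g" "bounded_borel h"
  shows "bounded_borel (\<lambda>x. g x * h x)"
proof -
  obtain B C where "\<And>x. \<bar>g x\<bar> \<le> B" "\<And>x. \<bar>h x\<bar> \<le> C" using assms by (auto simp: bounded_borel_def)
  then have "\<bar>g x * h x\<bar> \<le> B * C" for x
    unfolding abs_mult using order.trans[OF abs_ge_zero] by (intro mult_mono) auto
  then show ?thesis using assms by (intro bounded_borelI) (auto simp: bounded_borel_def)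
qed

lemma bounded_borel_diff:
  assumes "bounded_borel g" "bounded_borel h"
  shows "bounded_borel (\<lambda>x. g x - h x)"
  using bounded_borel_add[OF assms(1) bounded_borel_mult[OF bounded_borel_const[of "-1"] assms(2)]] by simp

lemma bounded_borel_sum:
  assumes "\<And>i. i \<in> I \<Longrightarrow> bounded_borel (g i)"
  shows "bounded_borel (\<lambda>x. \<Sum>i\<in>I. g i x)"
  using assms
  by (induction I rule: infinite_finite_induct) (auto simp: bounded_borel_const intro!: bounded_borel_add)

lemmas bounded_borel_intros = bounded_borel_const bounded_borel_indicator bounded_borel_add
  bounded_borel_mult bounded_borel_diff bounded_borel_sum

section \<open>A stationary kernel with a minorization\<close>

locale minorized_kernel =
  fixes \<pi> :: "'a::topological_space measure" and P :: "'a \<Rightarrow> 'a measure" and \<nu> :: "'a measure"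
    and J :: "'a set" and \<beta> :: real
  assumes prob_\<pi>: "prob_space \<pi>" and sets_\<pi>[measurable_cong]: "sets \<pi> = sets borel"
    and P_meas: "P \<in> borel \<rightarrow>\<^sub>M prob_algebra borel"
    and irred: "pi_irreducible \<pi> P"
    and inv: "bind \<pi> P = \<pi>"
    and J[measurable]: "J \<in> sets borel" and \<pi>_J: "emeasure \<pi> J > 0" and \<beta>: "\<beta> > 0"
    and prob_\<nu>: "prob_space \<nu>" and sets_\<nu>[measurable_cong]: "sets \<nu> = sets borel"
    and minor: "\<And>x A. A \<in> sets borel \<Longrightarrow> emeasure (P x) A \<ge> ennreal (\<beta> * indicator J x) * emeasure \<nu> A"
begin

sublocale \<pi>: prob_space \<pi> by (rule prob_\<pi>)
sublocale \<nu>: prob_space \<nu> by (rule prob_\<nu>)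

lemma prob_P: "prob_space (P x)" and sets_P: "sets (P x) = sets borel"
  using measurable_space[OF P_meas, of x] by (auto simp: space_prob_algebra)

lemma P_subprob: "P \<in> borel \<rightarrow>\<^sub>M subprob_algebra borel"
  by (rule measurable_prob_algebraD[OF P_meas])

lemma P_subprob_\<pi>: "P \<in> \<pi> \<rightarrow>\<^sub>M subprob_algebra borel"
  using P_subprob by (simp add: measurable_cong_sets[OF sets_\<pi> refl])

definition Pop :: "('a \<Rightarrow> real) \<Rightarrow> 'a \<Rightarrow> real" where
  "Pop g x = (\<integral>y. g y \<partial>P x)"

text \<open>The unnormalised residual kernel, which moves the chain without regenerating.\<close>

definition Kop :: "('a \<Rightarrow> real) \<Rightarrow> 'a \<Rightarrow> real" where
  "Kop g x = Pop g x - \<beta> * indicator J x * (\<integral>y. g y \<partial>\<nu>)"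

lemma integrable_bounded_borel:
  assumes "bounded_borel g"
  shows "integrable (P x) g" "integrable \<nu> g" "integrable \<pi> g"
  using bounded_borel_integrable[OF assms] prob_P sets_P prob_\<nu> sets_\<nu> prob_\<pi> sets_\<pi> by auto

lemma bounded_borel_Pop:
  assumes g: "bounded_borel g"
  shows "bounded_borel (Pop g)"
proof -
  obtain B where B: "\<And>x. \<bar>g x\<bar> \<le> B" using g by (auto simp: bounded_borel_def)
  have "\<bar>Pop g x\<bar> \<le> B" for x
  proof -
    interpret P: prob_space "P x" by (rule prob_P)
    have "\<bar>Pop g x\<bar> \<le> (\<integral>y. \<bar>g y\<bar> \<partial>P x)" unfolding Pop_def by (rule integral_abs_bound)
    also have "\<dots> \<le> (\<integral>y. B \<partial>P x)"
      using B by (intro integral_mono) (auto intro: integrable_bounded_borel g)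
    finally show ?thesis by (simp add: P.prob_space)
  qed
  moreover have "Pop g \<in> borel_measurable borel"
    unfolding Pop_def
    using measurable_compose[OF P_subprob integral_measurable_subprob_algebra[OF bounded_borel_measurable[OF g]]] .
  ultimately show ?thesis by (intro bounded_borelI)
qed

lemma bounded_borel_Kop: "bounded_borel g \<Longrightarrow> bounded_borel (Kop g)"
  unfolding Kop_def by (intro bounded_borel_intros bounded_borel_Pop J)

lemma bounded_borel_Kop_pow: "bounded_borel g \<Longrightarrow> bounded_borel ((Kop ^^ n) g)"
  by (induction n) (auto intro: bounded_borel_Kop)

lemma Kop_add: "bounded_borel g \<Longrightarrow> bounded_borel h \<Longrightarrow> Kop (\<lambda>x. g x + h x) = (\<lambda>x. Kop g x + Kop h x)"
  by (auto simp: Kop_def Pop_def integrable_bounded_borel algebra_simps)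

lemma Kop_cmult: "Kop (\<lambda>x. c * g x) = (\<lambda>x. c * Kop g x)"
  by (auto simp: Kop_def Pop_def algebra_simps)

lemma Kop_pow_add:
  assumes "bounded_borel g" "bounded_borel h"
  shows "(Kop ^^ n) (\<lambda>x. g x + h x) = (\<lambda>x. (Kop ^^ n) g x + (Kop ^^ n) h x)"
  using assms by (induction n) (auto simp: Kop_add bounded_borel_Kop_pow)

lemma Kop_pow_cmult: "(Kop ^^ n) (\<lambda>x. c * g x) = (\<lambda>x. c * (Kop ^^ n) g x)"
  by (induction n) (auto simp: Kop_cmult)

text \<open>The minorization says that the scaled measure \<nu> lies below \<open>P x\<close> on
  every set; monotonicity of the integral in the measure carries this over to non-negative
  functions.\<close>

lemma Kop_nonneg:
  assumes g: "bounded_borel g" "\<And>x. 0 \<le> g x"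
  shows "0 \<le> Kop g x"
proof -
  have [measurable]: "g \<in> borel_measurable borel" by (rule bounded_borel_measurable[OF g(1)])
  have "scale_measure (ennreal (\<beta> * indicator J x)) \<nu> \<le> P x"
    unfolding le_measure_iff using minor sets_\<nu> sets_P[of x]
    by (auto simp: le_fun_def sets_eq_imp_space_eq[OF sets_\<nu>] sets_eq_imp_space_eq[OF sets_P] emeasure_notin_sets)
      (metis emeasure_neq_0_sets le_zero_eq mult_zero_right zero_le)
  then have "(\<integral>\<^sup>+y. ennreal (g y) \<partial>scale_measure (ennreal (\<beta> * indicator J x)) \<nu>) \<le> (\<integral>\<^sup>+y. ennreal (g y) \<partial>P x)"
    by (intro nn_integral_mono_measure) (simp_all add: sets_\<nu> sets_P)
  also have "(\<integral>\<^sup>+y. ennreal (g y) \<partial>scale_measure (ennreal (\<beta> * indicator J x)) \<nu>)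
      = ennreal (\<beta> * indicator J x) * (\<integral>\<^sup>+y. ennreal (g y) \<partial>\<nu>)"
    by (rule nn_integral_scale_measure) measurable
  finally have "ennreal (\<beta> * indicator J x * (\<integral>y. g y \<partial>\<nu>)) \<le> ennreal (\<integral>y. g y \<partial>P x)"
    using \<beta> g integrable_bounded_borel[OF g(1)]
    by (simp add: nn_integral_eq_integral ennreal_mult)
  then show ?thesis
    using g(2) by (subst (asm) ennreal_le_iff) (auto simp: Kop_def Pop_def)
qed

lemma Kop_pow_nonneg: "bounded_borel g \<Longrightarrow> (\<And>x. 0 \<le> g x) \<Longrightarrow> 0 \<le> (Kop ^^ n) g x"
  by (induction n arbitrary: x) (auto intro!: Kop_nonneg bounded_borel_Kop_pow)

lemma Kop_one: "Kop (\<lambda>_. 1) x = 1 - \<beta> * indicator J x"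
  using prob_space.prob_space[OF prob_P[of x]] by (simp add: Kop_def Pop_def \<nu>.prob_space)

text \<open>A positive functional that annihilates constants annihilates bounded functions:
  positivity is applied to \<open>B + g\<close> and \<open>B - g\<close>.\<close>

lemma Kop_eq_0:
  assumes g: "bounded_borel g" and x: "1 - \<beta> * indicator J x = 0"
  shows "Kop g x = 0"
proof -
  obtain B where B: "\<And>x. \<bar>g x\<bar> \<le> B" using g by (auto simp: bounded_borel_def)
  have const: "Kop (\<lambda>_. B) x = 0" using Kop_cmult[of B "\<lambda>_. 1"] x by (simp add: Kop_one fun_eq_iff)
  have "0 \<le> B + s * g y" if "s = 1 \<or> s = -1" for s y using B[of y] that by auto
  then have "0 \<le> Kop (\<lambda>y. B + s * g y) x" if "s = 1 \<or> s = -1" for s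
    using that by (intro Kop_nonneg bounded_borel_intros g)
  moreover have "Kop (\<lambda>y. B + s * g y) x = s * Kop g x" for s
    using Kop_add[OF bounded_borel_const[of B] bounded_borel_mult[OF bounded_borel_const[of s] g]]
    by (simp add: Kop_cmult const)
  ultimately have "0 \<le> s * Kop g x" if "s = 1 \<or> s = -1" for s using that by auto
  from this[of 1] this[of "-1"] show ?thesis by simp
qed

text \<open>When the normalising factor vanishes, the quotient in the residual kernel is the junk value
  \<open>0\<close>, but then the unnormalised residual kernel vanishes as well.\<close>

lemma residual_eq_Kop:
  assumes "bounded_borel g"
  shows "(1 - \<beta> * indicator J x) * Q_int P \<beta> J \<nu> x g = Kop g x"
  using Kop_eq_0[OF assms, of x]
  by (cases "1 - \<beta> * indicator J x = 0") (auto simp: Q_int_def Kop_def Pop_def)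

lemma split_cyl_replicate:
  assumes "bounded_borel (split_cyl P \<beta> J \<nu> L)"
  shows "split_cyl P \<beta> J \<nu> (replicate n (UNIV, False) @ L) = (Kop ^^ n) (split_cyl P \<beta> J \<nu> L)"
proof (induction n)
  case (Suc n)
  show ?case
    unfolding replicate_Suc append_Cons split_cyl.simps Suc
    by (simp add: split_prob_def fun_eq_iff residual_eq_Kop bounded_borel_Kop_pow[OF assms])
qed simp

lemma split_cyl_True: "split_cyl P \<beta> J \<nu> [(A, True)] = (\<lambda>x. indicator A x * (\<beta> * indicator J x))"
  by (simp add: split_prob_def fun_eq_iff \<nu>.prob_space)

lemma split_cyl_False: "split_cyl P \<beta> J \<nu> [(A, False)] = (\<lambda>x. indicator A x * (1 - \<beta> * indicator J x))"
  using residual_eq_Kop[OF bounded_borel_const[of 1]]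
  by (simp add: split_prob_def fun_eq_iff Kop_one mult.assoc)

section \<open>Iterating the stationarity equation\<close>

lemma integral_Pop:
  assumes g: "bounded_borel g"
  shows "(\<integral>x. Pop g x \<partial>\<pi>) = (\<integral>x. g x \<partial>\<pi>)"
proof -
  obtain B where B: "\<And>x. \<bar>g x\<bar> \<le> B" using g by (auto simp: bounded_borel_def)
  have "integral\<^sup>L (bind \<pi> P) g = (\<integral>x. integral\<^sup>L (P x) g \<partial>\<pi>)"
    using prob_space.emeasure_space_1[OF prob_P]
    by (intro integral_bind[where B' = 1, OF bounded_borel_measurable[OF g] B P_subprob_\<pi> \<pi>.finite_measure_axioms]) simp
  then show ?thesis by (simp add: inv Pop_def)
qed

text \<open>The stationary probability that a given step triggers a regeneration.\<close>

definition rate :: real where "rate = \<beta> * measure \<pi> J"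

lemma rate_pos: "rate > 0"
  using \<pi>_J \<beta> by (simp add: rate_def \<pi>.emeasure_eq_measure)

lemma integral_Kop:
  assumes g: "bounded_borel g"
  shows "(\<integral>x. Kop g x \<partial>\<pi>) = (\<integral>x. g x \<partial>\<pi>) - rate * (\<integral>x. g x \<partial>\<nu>)"
proof -
  have "(\<integral>x. Kop g x \<partial>\<pi>) = (\<integral>x. Pop g x \<partial>\<pi>) - (\<integral>x. \<beta> * indicator J x * (\<integral>y. g y \<partial>\<nu>) \<partial>\<pi>)"
    unfolding Kop_def
    by (intro Bochner_Integration.integral_diff integrable_bounded_borel bounded_borel_intros bounded_borel_Pop g J)
  then show ?thesis by (simp add: integral_Pop[OF g] rate_def sets_\<pi>)
qed

text \<open>Telescoping of \<open>integral_Kop\<close> along the iterates of \<open>Kop\<close>. The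
  first summand is the remainder that has to be shown to vanish.\<close>

lemma integral_decomposition:
  assumes g: "bounded_borel g"
  shows "(\<integral>x. g x \<partial>\<pi>) = (\<integral>x. (Kop ^^ n) g x \<partial>\<pi>) + rate * (\<Sum>k<n. \<integral>x. (Kop ^^ k) g x \<partial>\<nu>)"
  by (induction n) (simp_all add: integral_Kop[OF bounded_borel_Kop_pow[OF g]] algebra_simps)

abbreviation tail :: "nat \<Rightarrow> ('a \<Rightarrow> real) \<Rightarrow> real" where
  "tail n g \<equiv> \<integral>x. (Kop ^^ n) g x \<partial>\<pi>"

lemma tail_add: "bounded_borel g \<Longrightarrow> bounded_borel h \<Longrightarrow> tail n (\<lambda>x. g x + h x) = tail n g + tail n h"
  by (simp add: Kop_pow_add integrable_bounded_borel bounded_borel_Kop_pow)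

lemma tail_cmult: "tail n (\<lambda>x. c * g x) = c * tail n g"
  by (simp add: Kop_pow_cmult)

lemma tail_nonneg: "bounded_borel g \<Longrightarrow> (\<And>x. 0 \<le> g x) \<Longrightarrow> 0 \<le> tail n g"
  by (intro integral_nonneg_AE AE_I2 Kop_pow_nonneg)

lemma tail_mono:
  assumes "bounded_borel g" "bounded_borel h" "\<And>x. g x \<le> h x"
  shows "tail n g \<le> tail n h"
  using tail_add[OF assms(1) bounded_borel_diff[OF assms(2,1)], of n]
    tail_nonneg[OF bounded_borel_diff[OF assms(2,1)], of n] assms(3) by simp

lemma tail_le_integral:
  assumes "bounded_borel g" "\<And>x. 0 \<le> g x"
  shows "tail n g \<le> (\<integral>x. g x \<partial>\<pi>)"
  using integral_decomposition[OF assms(1), of n] rate_pos assms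
  by (simp add: sum_nonneg integral_nonneg_AE Kop_pow_nonneg)

text \<open>Since \<open>Kop\<close> maps \<open>1\<close> to
  \<open>1 - \<beta> * indicator J\<close>, the tails of \<open>1\<close> decrease by \<beta> times
  the tails of \<open>indicator J\<close>. They are bounded below, hence converge, and their
  differences tend to zero.\<close>

lemma tail_J_tendsto_0: "(\<lambda>n. tail n (indicator J)) \<longlonglongrightarrow> 0"
proof -
  have dec: "tail (Suc n) (\<lambda>_. 1) = tail n (\<lambda>_. 1) - \<beta> * tail n (indicator J)" for n
  proof -
    have "Kop (\<lambda>_. 1) = (\<lambda>x. 1 + (- \<beta>) * indicator J x)" by (simp add: fun_eq_iff Kop_one)
    then have "tail (Suc n) (\<lambda>_. 1) = tail n (\<lambda>x. 1 + (- \<beta>) * indicator J x)"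
      by (simp only: funpow_Suc_right o_apply)
    also have "\<dots> = tail n (\<lambda>_. 1) + (- \<beta>) * tail n (indicator J)"
      by (simp only: tail_add[OF bounded_borel_const bounded_borel_mult[OF bounded_borel_const bounded_borel_indicator[OF J]]] tail_cmult)
    finally show ?thesis by simp
  qed
  have J_nonneg: "0 \<le> tail n (indicator J)" for n
    by (intro tail_nonneg bounded_borel_indicator J) simp
  have "decseq (\<lambda>n. tail n (\<lambda>_. 1))"
    using dec J_nonneg \<beta> by (intro decseq_SucI) simp
  moreover have "0 \<le> tail n (\<lambda>_. 1)" for n by (intro tail_nonneg bounded_borel_const) simp
  ultimately obtain l where l: "(\<lambda>n. tail n (\<lambda>_. 1)) \<longlonglongrightarrow> l"
    using decseq_convergent[of "\<lambda>n. tail n (\<lambda>_. 1)" 0] by blast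
  have "(\<lambda>n. (tail n (\<lambda>_. 1) - tail (Suc n) (\<lambda>_. 1)) / \<beta>) \<longlonglongrightarrow> (l - l) / \<beta>"
    by (intro tendsto_intros l LIMSEQ_Suc[OF l]) (use \<beta> in simp)
  moreover have "(\<lambda>n. (tail n (\<lambda>_. 1) - tail (Suc n) (\<lambda>_. 1)) / \<beta>) = (\<lambda>n. tail n (indicator J))"
    unfolding dec using \<beta> by simp
  ultimately show ?thesis by simp
qed

text \<open>\<open>Pop g\<close> differs from \<open>Kop g\<close> by a multiple of
  \<open>indicator J\<close>, and applying \<open>Kop\<close> merely shifts the index of the
  tail.\<close>

lemma tail_Pop_tendsto_0:
  assumes g: "bounded_borel g" and lim: "(\<lambda>n. tail n g) \<longlonglongrightarrow> 0"
  shows "(\<lambda>n. tail n (Pop g)) \<longlonglongrightarrow> 0"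
proof -
  have "Pop g = (\<lambda>x. Kop g x + (\<beta> * (\<integral>y. g y \<partial>\<nu>)) * indicator J x)"
    by (simp add: fun_eq_iff Kop_def)
  then have "tail n (Pop g) = tail n (\<lambda>x. Kop g x + (\<beta> * (\<integral>y. g y \<partial>\<nu>)) * indicator J x)" for n
    by simp
  also have "tail n (\<lambda>x. Kop g x + (\<beta> * (\<integral>y. g y \<partial>\<nu>)) * indicator J x)
      = tail n (Kop g) + (\<beta> * (\<integral>y. g y \<partial>\<nu>)) * tail n (indicator J)" for n
    by (simp only: tail_add[OF bounded_borel_Kop[OF g] bounded_borel_mult[OF bounded_borel_const bounded_borel_indicator[OF J]]] tail_cmult)
  also have "tail n (Kop g) = tail (Suc n) g" for n
    by (simp only: funpow_Suc_right o_apply)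
  finally have eq: "(\<lambda>n. tail n (Pop g)) = (\<lambda>n. tail (Suc n) g + (\<beta> * (\<integral>y. g y \<partial>\<nu>)) * tail n (indicator J))"
    by (rule ext)
  have "(\<lambda>n. tail (Suc n) g + (\<beta> * (\<integral>y. g y \<partial>\<nu>)) * tail n (indicator J)) \<longlonglongrightarrow> 0 + (\<beta> * (\<integral>y. g y \<partial>\<nu>)) * 0"
    by (intro tendsto_intros LIMSEQ_Suc[OF lim] tail_J_tendsto_0)
  then show ?thesis unfolding eq by simp
qed

lemma bounded_borel_Pop_pow: "bounded_borel g \<Longrightarrow> bounded_borel ((Pop ^^ n) g)"
  by (induction n) (auto intro: bounded_borel_Pop)

lemma Pop_pow_nonneg: "(\<And>x. 0 \<le> g x) \<Longrightarrow> 0 \<le> (Pop ^^ n) g x"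
  by (induction n arbitrary: x) (auto simp: Pop_def intro!: integral_nonneg_AE)

lemma kernel_pow_prob: "kernel_pow P n \<in> borel \<rightarrow>\<^sub>M prob_algebra borel"
proof (induction n)
  case 0
  show ?case by (simp add: measurable_return_prob_space)
next
  case (Suc n)
  show ?case unfolding kernel_pow.simps by (rule measurable_bind_prob_space[OF Suc P_meas])
qed

text \<open>Links the kernel powers in the irreducibility hypothesis to iterates of
  \<open>Pop\<close>. \<open>kernel_pow\<close> appends its newest step at the end, so the induction
  replaces \<open>g\<close> by \<open>Pop g\<close>.\<close>

lemma integral_kernel_pow:
  assumes "bounded_borel g"
  shows "(\<integral>y. g y \<partial>kernel_pow P n x) = (Pop ^^ n) g x"
  using assms
proof (induction n arbitrary: g)
  case 0
  then show ?case by (simp add: integral_return bounded_borel_measurable)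
next
  case (Suc n)
  obtain B where B: "\<And>x. \<bar>g x\<bar> \<le> B" using Suc.prems by (auto simp: bounded_borel_def)
  have kp: "prob_space (kernel_pow P n x)" "sets (kernel_pow P n x) = sets borel"
    using measurable_space[OF kernel_pow_prob, of x n] by (auto simp: space_prob_algebra)
  interpret K: prob_space "kernel_pow P n x" by (rule kp)
  have "integral\<^sup>L (bind (kernel_pow P n x) P) g = (\<integral>y. integral\<^sup>L (P y) g \<partial>kernel_pow P n x)"
    using prob_space.emeasure_space_1[OF prob_P] P_subprob
    by (intro integral_bind[where B' = 1, OF bounded_borel_measurable[OF Suc.prems] B _ K.finite_measure_axioms])
      (simp_all add: measurable_cong_sets[OF kp(2) refl])
  also have "\<dots> = (\<integral>y. Pop g y \<partial>kernel_pow P n x)" by (simp add: Pop_def)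
  also have "\<dots> = (Pop ^^ n) (Pop g) x" by (rule Suc.IH[OF bounded_borel_Pop[OF Suc.prems]])
  finally show ?case by (simp only: kernel_pow.simps funpow_Suc_right o_apply)
qed

lemma ex_Pop_pow_pos: "\<exists>n. 0 < (Pop ^^ n) (indicator J) x"
proof -
  obtain n where n: "emeasure (kernel_pow P n x) J > 0"
    using irred \<pi>_J J unfolding pi_irreducible_def by blast
  have kp: "prob_space (kernel_pow P n x)" "sets (kernel_pow P n x) = sets borel"
    using measurable_space[OF kernel_pow_prob, of x n] by (auto simp: space_prob_algebra)
  interpret K: prob_space "kernel_pow P n x" by (rule kp)
  have "0 < measure (kernel_pow P n x) J" using n by (simp add: K.emeasure_eq_measure)
  also have "\<dots> = (Pop ^^ n) (indicator J) x"
    using integral_kernel_pow[OF bounded_borel_indicator[OF J], of n x] kp(2) J by simp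
  finally show ?thesis ..
qed

text \<open>Here irreducibility enters. The constant \<open>1\<close> is dominated by
  \<open>h m\<close>, whose tails vanish for fixed \<open>m\<close>, plus the indicator of the
  exceptional set \<open>B m\<close>, whose tails are at most its \<pi>-measure. The sets
  \<open>B m\<close> decrease to the empty set because every point reaches \<open>J\<close> with
  positive probability.\<close>

lemma tail_one_tendsto_0: "(\<lambda>n. tail n (\<lambda>_. 1)) \<longlonglongrightarrow> 0"
proof -
  \<comment> \<open>Summing over \<open>k \<le> m\<close> eventually includes a positive term at
    each point, and the factor \<open>m\<close> then pushes the value above
    \<open>1\<close>.\<close>
  define h where "h = (\<lambda>m x. real m * (\<Sum>k\<le>m. (Pop ^^ k) (indicator J) x))"
  define B where "B = (\<lambda>m. {x. h m x < 1})"
  have h_bm: "bounded_borel (h m)" for m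
    unfolding h_def by (intro bounded_borel_intros bounded_borel_Pop_pow J)
  have [measurable]: "h m \<in> borel_measurable borel" for m by (rule bounded_borel_measurable[OF h_bm])
  have B[measurable]: "B m \<in> sets borel" for m unfolding B_def by measurable
  have "(\<lambda>n. tail n ((Pop ^^ k) (indicator J))) \<longlonglongrightarrow> 0" for k
    by (induction k) (auto intro!: tail_J_tendsto_0 tail_Pop_tendsto_0 bounded_borel_Pop_pow bounded_borel_indicator J)
  moreover have "tail n (\<lambda>x. \<Sum>k\<in>A. (Pop ^^ k) (indicator J) x) = (\<Sum>k\<in>A. tail n ((Pop ^^ k) (indicator J)))"
    if "finite A" for A n
    using that
  proof induction
    case empty
    then show ?case using tail_cmult[of n 0 "\<lambda>_. 0"] by simp
  next
    case (insert k A)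
    then show ?case
      using tail_add[of "(Pop ^^ k) (indicator J)" "\<lambda>x. \<Sum>k\<in>A. (Pop ^^ k) (indicator J) x" n]
      by (simp add: bounded_borel_intros bounded_borel_Pop_pow J)
  qed
  ultimately have h_lim: "(\<lambda>n. tail n (h m)) \<longlonglongrightarrow> 0" for m
    unfolding h_def tail_cmult by (auto intro!: tendsto_mult_right_zero tendsto_null_sum)
  have bound: "tail n (\<lambda>_. 1) \<le> tail n (h m) + measure \<pi> (B m)" for n m
  proof -
    have "0 \<le> h m x" for x unfolding h_def by (intro mult_nonneg_nonneg sum_nonneg Pop_pow_nonneg) auto
    then have "tail n (\<lambda>_. 1) \<le> tail n (\<lambda>x. h m x + indicator (B m) x)"
      by (intro tail_mono bounded_borel_intros h_bm B) (auto simp: B_def split: split_indicator)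
    also have "\<dots> = tail n (h m) + tail n (indicator (B m))"
      by (intro tail_add h_bm bounded_borel_indicator B)
    also have "tail n (indicator (B m)) \<le> (\<integral>x. indicator (B m) x \<partial>\<pi>)"
      by (intro tail_le_integral bounded_borel_indicator B) auto
    finally show ?thesis using B by (simp add: sets_\<pi>)
  qed
  have "decseq B"
  proof (rule decseq_SucI, rule subsetI)
    fix m x assume "x \<in> B (Suc m)"
    moreover have "h m x \<le> h (Suc m) x"
      unfolding h_def by (intro mult_mono sum_mono2) (auto intro!: sum_nonneg Pop_pow_nonneg)
    ultimately show "x \<in> B m" by (auto simp: B_def)
  qed
  then have "(\<lambda>m. measure \<pi> (B m)) \<longlonglongrightarrow> measure \<pi> (\<Inter>m. B m)"
    using B by (intro \<pi>.finite_Lim_measure_decseq) (auto simp: sets_\<pi>)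
  also have "(\<Inter>m. B m) = {}"
  proof -
    have "\<exists>m. x \<notin> B m" for x
    proof -
      obtain n where n: "0 < (Pop ^^ n) (indicator J) x" using ex_Pop_pow_pos by blast
      obtain k where k: "1 < real k * (Pop ^^ n) (indicator J) x"
        using reals_Archimedean3[OF n] by blast
      define m where "m = max k n"
      have "1 < real k * (Pop ^^ n) (indicator J) x" by (rule k)
      also have "\<dots> \<le> h m x"
        unfolding h_def
      proof (intro mult_mono)
        show "(Pop ^^ n) (indicator J) x \<le> (\<Sum>k\<le>m. (Pop ^^ k) (indicator J) x)"
          by (intro member_le_sum) (auto simp: m_def intro!: Pop_pow_nonneg)
      qed (auto simp: m_def intro!: Pop_pow_nonneg)
      finally have "x \<notin> B m" by (simp add: B_def)
      then show ?thesis ..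
    qed
    then show ?thesis by blast
  qed
  finally have B_lim: "(\<lambda>m. measure \<pi> (B m)) \<longlonglongrightarrow> 0" by simp
  show ?thesis
  proof (rule LIMSEQ_I)
    fix e :: real assume "e > 0"
    then obtain m where m: "measure \<pi> (B m) < e / 2"
      using order_tendstoD(2)[OF B_lim, of "e / 2"] by (auto simp: eventually_sequentially)
    obtain N where N: "\<And>n. n \<ge> N \<Longrightarrow> tail n (h m) < e / 2"
      using order_tendstoD(2)[OF h_lim[of m], of "e / 2"] \<open>e > 0\<close> by (auto simp: eventually_sequentially)
    have "norm (tail n (\<lambda>_. 1) - 0) < e" if "n \<ge> N" for n
      using bound[of n m] m N[OF that] tail_nonneg[OF bounded_borel_const[of 1], of n] by simp
    then show "\<exists>N. \<forall>n\<ge>N. norm (tail n (\<lambda>_. 1) - 0) < e" by blast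
  qed
qed

text \<open>The remainder for an indicator lies between \<open>0\<close> and the remainder for
  \<open>1\<close>, so letting \<open>n\<close> grow in \<open>integral_decomposition\<close> leaves
  the full series.\<close>

lemma occupation_sums:
  assumes A: "A \<in> sets borel"
  shows "(\<lambda>k. rate * (\<integral>x. (Kop ^^ k) (indicator A) x \<partial>\<nu>)) sums measure \<pi> A"
proof -
  have bm: "bounded_borel (indicator A :: 'a \<Rightarrow> real)" by (rule bounded_borel_indicator[OF A])
  have "(\<lambda>n. tail n (indicator A)) \<longlonglongrightarrow> 0"
  proof (rule tendsto_sandwich[OF _ _ tendsto_const tail_one_tendsto_0])
    show "\<forall>\<^sub>F n in sequentially. 0 \<le> tail n (indicator A)"
      by (intro always_eventually allI tail_nonneg bm) simp
    show "\<forall>\<^sub>F n in sequentially. tail n (indicator A) \<le> tail n (\<lambda>_. 1)"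
      by (intro always_eventually allI tail_mono bm bounded_borel_const) (simp add: indicator_le_1)
  qed
  then have "(\<lambda>n. measure \<pi> A - tail n (indicator A)) \<longlonglongrightarrow> measure \<pi> A - 0"
    by (intro tendsto_intros)
  moreover have "measure \<pi> A - tail n (indicator A) = (\<Sum>k<n. rate * (\<integral>x. (Kop ^^ k) (indicator A) x \<partial>\<nu>))" for n
    using integral_decomposition[OF bm, of n] A by (simp add: sets_\<pi> sum_distrib_left)
  ultimately show ?thesis by (simp add: sums_def)
qed

end

section \<open>The split chain as a regenerative process\<close>

locale minorized_split_chain = minorized_kernel \<pi> P \<nu> J \<beta>
  for \<pi> :: "'a::topological_space measure" and P \<nu> J \<beta> +
  fixes M :: "'w measure" and X :: "nat \<Rightarrow> 'w \<Rightarrow> 'a" and \<Gamma> :: "nat \<Rightarrow> 'w \<Rightarrow> bool"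
  assumes chain: "split_chain M X \<Gamma> P \<beta> J \<nu>"
begin

definition Law :: "(nat \<Rightarrow> 'a \<times> bool) measure" where "Law = path_law M X \<Gamma>"

lemma sets_Law[measurable_cong]: "sets Law = sets path_space"
  by (simp add: Law_def sets_path_law)

lemma prob_Law: "prob_space Law"
  unfolding Law_def by (rule prob_space_path_law[OF chain prob_\<nu>])

sublocale Law: prob_space Law by (rule prob_Law)

text \<open>Cylinders prescribe the flag at the last coordinate too, whereas the event leaves it
  free. Adding the two choices of that flag turns the last factor into
  \<open>indicator A\<close>.\<close>

lemma emeasure_no_regen_before:
  assumes A: "A \<in> sets borel"
  shows "emeasure Law {z. (\<forall>i<n. \<not> snd (z i)) \<and> fst (z n) \<in> A} =
    ennreal (\<integral>x. (Kop ^^ n) (indicator A) x \<partial>\<nu>)"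
proof -
  define C where "C = (\<lambda>g. replicate n (UNIV :: 'a set, False) @ [(A, g)])"
  have bl: "borel_list (C g)" for g
    using A by (auto simp: borel_list_def C_def nth_append)
  have mem: "z \<in> cylinder (C g) \<longleftrightarrow> (\<forall>i<n. \<not> snd (z i)) \<and> fst (z n) \<in> A \<and> snd (z n) = g" for z g
    by (auto simp: cylinder_def C_def nth_append less_Suc_eq)
  have bm: "bounded_borel (split_cyl P \<beta> J \<nu> [(A, g)])" for g
    by (cases g) (auto simp only: split_cyl_True split_cyl_False intro!: bounded_borel_intros A J)
  have m: "measure Law (cylinder (C g)) = (\<integral>x. (Kop ^^ n) (split_cyl P \<beta> J \<nu> [(A, g)]) x \<partial>\<nu>)" for g
    unfolding Law_def measure_path_law_cylinder[OF chain prob_\<nu> bl] unfolding C_def split_cyl_replicate[OF bm] ..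
  have "{z. (\<forall>i<n. \<not> snd (z i)) \<and> fst (z n) \<in> A} = cylinder (C True) \<union> cylinder (C False)"
    by (auto simp: mem)
  then have "measure Law {z. (\<forall>i<n. \<not> snd (z i)) \<and> fst (z n) \<in> A}
      = measure Law (cylinder (C True)) + measure Law (cylinder (C False))"
    using sets_cylinder[OF bl] by (simp only:) (intro Law.finite_measure_Union, auto simp: sets_Law mem)
  also have "\<dots> = (\<integral>x. (Kop ^^ n) (\<lambda>x. split_cyl P \<beta> J \<nu> [(A, True)] x + split_cyl P \<beta> J \<nu> [(A, False)] x) x \<partial>\<nu>)"
    unfolding m Kop_pow_add[OF bm bm]
    by (intro Bochner_Integration.integral_add[symmetric] integrable_bounded_borel bounded_borel_Kop_pow bm)
  also have "(\<lambda>x. split_cyl P \<beta> J \<nu> [(A, True)] x + split_cyl P \<beta> J \<nu> [(A, False)] x) = indicator A"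
    unfolding split_cyl_True split_cyl_False by (simp add: fun_eq_iff algebra_simps)
  finally show ?thesis by (simp add: Law.emeasure_eq_measure)
qed

lemma occupation_measure:
  assumes A: "A \<in> sets borel"
  shows "ennreal rate * (\<Sum>n. emeasure Law {z. (\<forall>i<n. \<not> snd (z i)) \<and> fst (z n) \<in> A}) = emeasure \<pi> A"
proof -
  have nn: "0 \<le> (\<integral>x. (Kop ^^ k) (indicator A) x \<partial>\<nu>)" for k
    by (intro integral_nonneg_AE AE_I2 Kop_pow_nonneg bounded_borel_indicator A) simp
  have "(\<Sum>n. ennreal (rate * (\<integral>x. (Kop ^^ n) (indicator A) x \<partial>\<nu>))) = ennreal (measure \<pi> A)"
    using nn rate_pos by (intro suminf_ennreal_eq occupation_sums A) simp
  then show ?thesis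
    unfolding emeasure_no_regen_before[OF A] \<pi>.emeasure_eq_measure ennreal_suminf_cmult[symmetric]
    using rate_pos nn by (simp add: ennreal_mult)
qed

text \<open>A path without regeneration belongs to the no-flag event for every \<open>n\<close>.
  Positive probability would make the occupation series infinite, although
  \<open>occupation_measure\<close> on the whole space bounds it.\<close>

lemma AE_ex_regen: "AE z in Law. \<exists>i. snd (z i)"
proof -
  define N where "N = {z \<in> space Law. \<forall>i. \<not> snd (z i)}"
  have N[measurable]: "N \<in> sets path_space"
    using sets_eq_imp_space_eq[OF sets_Law] unfolding N_def by simp
  have "measure Law N = 0"
  proof (rule ccontr)
    assume "measure Law N \<noteq> 0"
    then have pos: "measure Law N > 0" using zero_less_measure_iff by blast
    have "(\<Sum>n. emeasure Law N) \<le> (\<Sum>n. emeasure Law {z. (\<forall>i<n. \<not> snd (z i)) \<and> fst (z n) \<in> UNIV})"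
    proof (intro suminf_le emeasure_mono)
      fix n
      have "{z \<in> space path_space. \<forall>i<n. \<not> snd (z i)} \<in> sets path_space" by measurable
      then show "{z. (\<forall>i<n. \<not> snd (z i)) \<and> fst (z n) \<in> UNIV} \<in> sets Law"
        by (simp add: sets_Law space_path_space)
    qed (auto simp: N_def)
    then have "ennreal rate * (\<Sum>n :: nat. emeasure Law N)
        \<le> ennreal rate * (\<Sum>n. emeasure Law {z. (\<forall>i<n. \<not> snd (z i)) \<and> fst (z n) \<in> UNIV})"
      by (rule mult_left_mono) simp
    also have "\<dots> = emeasure \<pi> UNIV" by (rule occupation_measure) simp
    finally have "ennreal rate * (\<Sum>n :: nat. emeasure Law N) \<le> emeasure \<pi> UNIV" .
    moreover have "(\<Sum>n :: nat. emeasure Law N) = \<infinity>"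
      using pos unfolding nn_integral_count_space_nat[symmetric]
      by (simp add: Law.emeasure_eq_measure ennreal_mult_top)
    ultimately show False
      using rate_pos \<pi>.emeasure_eq_measure[of UNIV] by (simp add: ennreal_mult_top top_unique)
  qed
  then have "N \<in> null_sets Law" by (simp add: null_sets_def Law.emeasure_eq_measure sets_Law)
  then show ?thesis by (rule AE_I') (auto simp: N_def)
qed

sublocale regenerative Law
proof
  show "sets Law = sets path_space" by (rule sets_Law)
  show "density Law (\<lambda>z. ennreal (if snd (z m) then 1 else 0)) =
      distr (density Law (\<lambda>z. ennreal (if snd (z m) then 1 else 0)) \<Otimes>\<^sub>M Law) path_space
        (\<lambda>(z, z'). comb_seq (Suc m) z z')" for m
    unfolding Law_def by (rule path_law_regen[OF chain prob_\<nu>])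
  show "AE z in Law. \<exists>i. snd (z i)" by (rule AE_ex_regen)
qed

end

section \<open>Kac's formula for block sums\<close>

context minorized_split_chain
begin

text \<open>Extends \<open>occupation_measure\<close> from sets to non-negative functions: both
  sides are additive, homogeneous and continuous along increasing sequences.\<close>

lemma occupation_nn_integral:
  assumes "g \<in> borel_measurable borel"
  shows "ennreal rate * (\<Sum>n. \<integral>\<^sup>+z. indicator {z. \<forall>i<n. \<not> snd (z i)} z * g (fst (z n)) \<partial>Law) = (\<integral>\<^sup>+x. g x \<partial>\<pi>)"
proof -
  define E where "E = (\<lambda>n. indicator {z :: nat \<Rightarrow> 'a \<times> bool. \<forall>i<n. \<not> snd (z i)} :: _ \<Rightarrow> ennreal)"
  have [measurable]: "E n \<in> borel_measurable path_space" for n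
  proof -
    have "{z \<in> space path_space. \<forall>i<n. \<not> snd (z i)} \<in> sets (path_space :: (nat \<Rightarrow> 'a \<times> bool) measure)"
      by measurable
    then show ?thesis unfolding E_def by (intro borel_measurable_indicator) (simp add: space_path_space)
  qed
  from assms have "ennreal rate * (\<Sum>n. \<integral>\<^sup>+z. E n z * g (fst (z n)) \<partial>Law) = (\<integral>\<^sup>+x. g x \<partial>\<pi>)"
  proof (induction rule: borel_measurable_induct)
    case (cong f g)
    then have "f = g" by auto
    with cong show ?case by simp
  next
    case (set A)
    have sets: "{z. (\<forall>i<n. \<not> snd (z i)) \<and> fst (z n) \<in> A} \<in> sets Law" for n
    proof -
      have [measurable]: "A \<in> sets borel" by fact
      have "{z \<in> space path_space. (\<forall>i<n. \<not> snd (z i)) \<and> fst (z n) \<in> A} \<in> sets path_space" by measurable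
      then show ?thesis by (simp add: sets_Law space_path_space)
    qed
    have "E n z * indicator A (fst (z n)) = indicator {z. (\<forall>i<n. \<not> snd (z i)) \<and> fst (z n) \<in> A} z" for n z
      by (auto simp: E_def split: split_indicator)
    then show ?case using occupation_measure[OF set] set by (simp add: sets sets_\<pi>)
  next
    case (mult u c)
    note [measurable] = mult(2)
    have "(\<integral>\<^sup>+z. E n z * (c * u (fst (z n))) \<partial>Law) = c * (\<integral>\<^sup>+z. E n z * u (fst (z n)) \<partial>Law)" for n
      unfolding mult.left_commute[of "E n _" c] by (rule nn_integral_cmult) measurable
    moreover have "(\<integral>\<^sup>+x. c * u x \<partial>\<pi>) = c * (\<integral>\<^sup>+x. u x \<partial>\<pi>)"
      by (rule nn_integral_cmult) measurable
    ultimately show ?case using mult.IH by (simp add: mult.left_commute[of _ c])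
  next
    case (add u v)
    note [measurable] = add(1,3)
    have "(\<integral>\<^sup>+z. E n z * (v (fst (z n)) + u (fst (z n))) \<partial>Law)
        = (\<integral>\<^sup>+z. E n z * v (fst (z n)) \<partial>Law) + (\<integral>\<^sup>+z. E n z * u (fst (z n)) \<partial>Law)" for n
      unfolding distrib_left by (rule nn_integral_add) measurable
    moreover have "(\<integral>\<^sup>+x. v x + u x \<partial>\<pi>) = (\<integral>\<^sup>+x. v x \<partial>\<pi>) + (\<integral>\<^sup>+x. u x \<partial>\<pi>)"
      by (rule nn_integral_add) measurable
    ultimately show ?case using add.IH by (simp add: suminf_add[symmetric] distrib_left)
  next
    case (seq U)
    note [measurable] = seq(1)
    have inc: "incseq (\<lambda>i. U i x)" for x using seq(3) by (auto simp: incseq_def le_fun_def)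
    have "(\<integral>\<^sup>+z. E n z * (SUP i. U i) (fst (z n)) \<partial>Law) = (SUP i. \<integral>\<^sup>+z. E n z * U i (fst (z n)) \<partial>Law)" for n
    proof -
      have "(\<integral>\<^sup>+z. E n z * (SUP i. U i) (fst (z n)) \<partial>Law) = (\<integral>\<^sup>+z. (SUP i. E n z * U i (fst (z n))) \<partial>Law)"
        by (simp add: SUP_mult_left_ennreal image_comp)
      also have "\<dots> = (SUP i. \<integral>\<^sup>+z. E n z * U i (fst (z n)) \<partial>Law)"
        using inc by (intro nn_integral_monotone_convergence_SUP)
          (auto simp: incseq_def le_fun_def intro!: mult_left_mono)
      finally show ?thesis .
    qed
    moreover have "(\<Sum>n. SUP i. \<integral>\<^sup>+z. E n z * U i (fst (z n)) \<partial>Law)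
        = (SUP i. \<Sum>n. \<integral>\<^sup>+z. E n z * U i (fst (z n)) \<partial>Law)"
      using inc by (intro ennreal_suminf_SUP_eq) (auto simp: incseq_def intro!: nn_integral_mono mult_left_mono)
    moreover have "(\<integral>\<^sup>+x. (SUP i. U i) x \<partial>\<pi>) = (SUP i. \<integral>\<^sup>+x. U i x \<partial>\<pi>)"
      using seq(3) unfolding SUP_apply by (intro nn_integral_monotone_convergence_SUP) auto
    ultimately show ?case using seq.IH by (simp add: SUP_mult_left_ennreal)
  qed
  then show ?thesis by (simp only: E_def)
qed

text \<open>Time \<open>n\<close> belongs to the first block exactly when no flag is set before
  \<open>n\<close>. Almost surely the occupation series therefore reduces to the finite block
  sum.\<close>

lemma kac_nn_integral:
  assumes g[measurable]: "g \<in> borel_measurable borel"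
  shows "ennreal rate * (\<integral>\<^sup>+z. (\<Sum>i<cycle_len z. g (fst (z i))) \<partial>Law) = (\<integral>\<^sup>+x. g x \<partial>\<pi>)"
proof -
  have E[measurable]: "(indicator {z :: nat \<Rightarrow> 'a \<times> bool. \<forall>i<n. \<not> snd (z i)} :: _ \<Rightarrow> ennreal)
      \<in> borel_measurable path_space" for n
  proof -
    have "{z \<in> space path_space. \<forall>i<n. \<not> snd (z i)} \<in> sets (path_space :: (nat \<Rightarrow> 'a \<times> bool) measure)"
      by measurable
    then show ?thesis by (intro borel_measurable_indicator) (simp add: space_path_space)
  qed
  have "AE z in Law. (\<Sum>i<cycle_len z. g (fst (z i))) = (\<Sum>n. indicator {z. \<forall>i<n. \<not> snd (z i)} z * g (fst (z n)))"
    using AE_ex_regen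
  proof eventually_elim
    case (elim z)
    have "(\<Sum>n. indicator {z. \<forall>i<n. \<not> snd (z i)} z * g (fst (z n)))
        = (\<Sum>n\<in>{..<cycle_len z}. indicator {z. \<forall>i<n. \<not> snd (z i)} z * g (fst (z n)))"
      using less_first_regen_iff[of "\<lambda>i. snd (z i)", OF elim]
      by (intro suminf_finite) (auto split: split_indicator)
    also have "\<dots> = (\<Sum>i<cycle_len z. g (fst (z i)))"
      using less_first_regen_iff[of "\<lambda>i. snd (z i)", OF elim] by (intro sum.cong) auto
    finally show ?case ..
  qed
  then have "(\<integral>\<^sup>+z. (\<Sum>i<cycle_len z. g (fst (z i))) \<partial>Law)
      = (\<integral>\<^sup>+z. (\<Sum>n. indicator {z. \<forall>i<n. \<not> snd (z i)} z * g (fst (z n))) \<partial>Law)"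
    by (rule nn_integral_cong_AE)
  also have "\<dots> = (\<Sum>n. \<integral>\<^sup>+z. indicator {z. \<forall>i<n. \<not> snd (z i)} z * g (fst (z n)) \<partial>Law)"
    by (rule nn_integral_suminf) measurable
  finally show ?thesis using occupation_nn_integral[OF g] by simp
qed

lemma block_sum_nonneg:
  fixes g :: "'a \<Rightarrow> real"
  assumes g: "integrable \<pi> g" "\<And>x. 0 \<le> g x" and [measurable]: "g \<in> borel_measurable borel"
  shows "integrable Law (\<lambda>z. \<Sum>i<cycle_len z. g (fst (z i)))"
    and "rate * (\<integral>z. (\<Sum>i<cycle_len z. g (fst (z i))) \<partial>Law) = (\<integral>x. g x \<partial>\<pi>)"
proof -
  let ?S = "\<lambda>z :: nat \<Rightarrow> 'a \<times> bool. \<Sum>i<cycle_len z. g (fst (z i))"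
  have [measurable]: "?S \<in> borel_measurable path_space"
    by (rule measurable_random_sum) measurable
  have nn: "0 \<le> ?S z" for z using g(2) by (auto intro: sum_nonneg)
  have "ennreal rate * (\<integral>\<^sup>+z. ennreal (?S z) \<partial>Law) = (\<integral>\<^sup>+x. ennreal (g x) \<partial>\<pi>)"
    using kac_nn_integral[of "\<lambda>x. ennreal (g x)"] g(2) by (simp add: sum_ennreal)
  also have "\<dots> = ennreal (\<integral>x. g x \<partial>\<pi>)"
    using g by (intro nn_integral_eq_integral) auto
  finally have eq: "ennreal rate * (\<integral>\<^sup>+z. ennreal (?S z) \<partial>Law) = ennreal (\<integral>x. g x \<partial>\<pi>)" .
  \<comment> \<open>An infinite integral times the positive \<open>rate\<close> would be infinite,
    contradicting integrability of \<open>g\<close> under \<pi>.\<close>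
  have "(\<integral>\<^sup>+z. ennreal (?S z) \<partial>Law) < \<infinity>"
  proof (rule ccontr)
    assume "\<not> ?thesis"
    then have "(\<integral>\<^sup>+z. ennreal (?S z) \<partial>Law) = \<top>" by (simp only: not_less infinity_ennreal_def top_unique)
    with eq rate_pos show False by (simp add: ennreal_mult_top)
  qed
  with nn show int: "integrable Law ?S"
    by (intro integrableI_nonneg) auto
  have "ennreal (rate * (\<integral>z. ?S z \<partial>Law)) = ennreal (\<integral>x. g x \<partial>\<pi>)"
    using eq nn_integral_eq_integral[OF int] nn rate_pos by (simp add: ennreal_mult integral_nonneg_AE)
  then show "rate * (\<integral>z. ?S z \<partial>Law) = (\<integral>x. g x \<partial>\<pi>)"
    using nn rate_pos g(2) by (subst (asm) ennreal_inj) (auto intro!: mult_nonneg_nonneg integral_nonneg_AE)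
qed

text \<open>Kac's formula is applied to the positive and negative parts separately; cancelling the
  positive \<open>rate\<close> shows that centring under \<pi> centres the block sum.\<close>

lemma block_sum_centered:
  fixes g :: "'a \<Rightarrow> real"
  assumes g: "integrable \<pi> g" "(\<integral>x. g x \<partial>\<pi>) = 0" and [measurable]: "g \<in> borel_measurable borel"
  shows "integrable Law (\<lambda>z. \<Sum>i<cycle_len z. g (fst (z i)))"
    and "(\<integral>z. (\<Sum>i<cycle_len z. g (fst (z i))) \<partial>Law) = 0"
proof -
  define p where "p = (\<lambda>x. max 0 (g x))"
  define q where "q = (\<lambda>x. max 0 (- g x))"
  have [measurable]: "p \<in> borel_measurable borel" "q \<in> borel_measurable borel"
    unfolding p_def q_def by measurable
  have int: "integrable \<pi> p" "integrable \<pi> q" using g(1) by (auto simp: p_def q_def)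
  have nn: "0 \<le> p x" "0 \<le> q x" "g x = p x - q x" for x by (auto simp: p_def q_def)
  note P = block_sum_nonneg[OF int(1) nn(1)] and Q = block_sum_nonneg[OF int(2) nn(2)]
  show "integrable Law (\<lambda>z. \<Sum>i<cycle_len z. g (fst (z i)))"
    unfolding nn(3) sum_subtractf by (intro Bochner_Integration.integrable_diff P(1) Q(1)) measurable
  have "rate * (\<integral>z. (\<Sum>i<cycle_len z. g (fst (z i))) \<partial>Law) = (\<integral>x. p x \<partial>\<pi>) - (\<integral>x. q x \<partial>\<pi>)"
    unfolding nn(3) sum_subtractf using P Q by (simp add: right_diff_distrib)
  also have "\<dots> = (\<integral>x. g x \<partial>\<pi>)" unfolding nn(3) using int by simp
  finally show "(\<integral>z. (\<Sum>i<cycle_len z. g (fst (z i))) \<partial>Law) = 0" using g(2) rate_pos by simp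
qed

end

section \<open>Both bounds, transferred from the path law to the given probability space\<close>

theorem theorem3p1:
  fixes \<pi> :: "'a::polish_space measure" and P :: "'a \<Rightarrow> 'a measure" and \<nu> :: "'a measure"
    and J :: "'a set" and \<beta> :: real and f :: "'a \<Rightarrow> real"
    and M :: "'w measure" and X :: "nat \<Rightarrow> 'w \<Rightarrow> 'a" and \<Gamma> :: "nat \<Rightarrow> 'w \<Rightarrow> bool"
    and n :: nat
    and \<theta> :: real and T :: "nat \<Rightarrow> 'w \<Rightarrow> nat" and \<Xi>1 :: "'w \<Rightarrow> real"
    and TR :: "'w \<Rightarrow> nat" and \<theta>hat :: "'w \<Rightarrow> real" and \<sigma>2 :: real and n0 :: real
  assumes "prob_space \<pi>" and "sets \<pi> = sets borel"
    and "P \<in> borel \<rightarrow>\<^sub>M prob_algebra borel"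
    and "pi_irreducible \<pi> P"
    and "bind \<pi> P = \<pi>"
    and "J \<in> sets borel" and "emeasure \<pi> J > 0" and "\<beta> > 0"
    and "prob_space \<nu>" and "sets \<nu> = sets borel"
    and "\<forall>x. \<forall>A\<in>sets borel. emeasure (P x) A \<ge> ennreal (\<beta> * indicator J x) * emeasure \<nu> A"
    and "split_chain M X \<Gamma> P \<beta> J \<nu>"
    and "f \<in> borel_measurable borel" and "integrable \<pi> f"
    and "n \<ge> 1"
  defines "\<theta> \<equiv> \<integral>x. f x \<partial>\<pi>"
    and "T \<equiv> \<lambda>k w. regen_time (\<lambda>i. \<Gamma> i w) k"
    and "\<Xi>1 \<equiv> \<lambda>w. \<Sum>i<T 1 w. (f (X i w) - \<theta>)"
    and "TR \<equiv> \<lambda>w. T (regen_index (\<lambda>i. \<Gamma> i w) n) w"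
    and "\<theta>hat \<equiv> \<lambda>w. (\<Sum>i<TR w. f (X i w)) / real (TR w)"
    and "\<sigma>2 \<equiv> (\<integral>w. (\<Xi>1 w)^2 \<partial>M) / (\<integral>w. real (T 1 w) \<partial>M)"
    and "n0 \<equiv> (\<integral>w. (real (T 1 w))^2 \<partial>M) / (\<integral>w. real (T 1 w) \<partial>M) - 1"
  assumes "(\<integral>\<^sup>+w. ennreal ((\<Xi>1 w)^2) \<partial>M) < \<infinity>"
    and "(\<integral>\<^sup>+w. ennreal ((real (T 1 w))^2) \<partial>M) < \<infinity>"
  shows "(\<integral>\<^sup>+w. ennreal ((\<theta>hat w - \<theta>)^2) \<partial>M)
           \<le> ennreal (\<sigma>2 / (real n)^2) * (\<integral>\<^sup>+w. ennreal (real (TR w)) \<partial>M)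
         \<and> (\<integral>\<^sup>+w. ennreal (real (TR w)) \<partial>M) \<le> ennreal (real n + n0)"
proof -
  interpret minorized_split_chain \<pi> P \<nu> J \<beta> M X \<Gamma>
    by (intro minorized_split_chain.intro minorized_kernel.intro minorized_split_chain_axioms.intro
        assms(1-10,12)) (use assms(11) in blast)
  have [measurable]: "f \<in> borel_measurable borel" by fact
  define Z where "Z = (\<lambda>w i. (X i w, \<Gamma> i w))"
  define \<phi> where "\<phi> = (\<lambda>x. f x - \<theta>)"
  define \<Xi> where "\<Xi> = (\<lambda>z :: nat \<Rightarrow> 'a \<times> bool. \<Sum>i<cycle_len z. \<phi> (fst (z i)))"
  define S where "S = (\<lambda>z :: nat \<Rightarrow> 'a \<times> bool. \<Sum>i<epoch n z. \<phi> (fst (z i)))"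
  have Z: "Z \<in> M \<rightarrow>\<^sub>M path_space" unfolding Z_def by (rule measurable_path[OF chain prob_\<nu>])
  have Law_eq: "Law = distr M path_space Z" by (simp add: Law_def path_law_def Z_def)
  have \<phi>[measurable]: "\<phi> \<in> borel_measurable borel" unfolding \<phi>_def by measurable
  have [measurable]: "\<Xi> \<in> borel_measurable path_space" "S \<in> borel_measurable path_space"
    unfolding \<Xi>_def S_def by (rule measurable_random_sum; measurable)+
  \<comment> \<open>All random quantities of the statement are functions of the path
    \<open>Z w\<close>, so their integrals can be computed under \<open>Law\<close>.\<close>
  have nn_transfer: "(\<integral>\<^sup>+w. h (Z w) \<partial>M) = (\<integral>\<^sup>+z. h z \<partial>Law)" if "h \<in> borel_measurable path_space" for h
    unfolding Law_eq using Z that by (simp add: nn_integral_distr)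
  have transfer: "(\<integral>w. h (Z w) \<partial>M) = (\<integral>z. h z \<partial>Law)" if "h \<in> borel_measurable path_space" for h :: "_ \<Rightarrow> real"
    unfolding Law_eq using Z that by (simp add: integral_distr)
  have T1: "T 1 w = cycle_len (Z w)" for w by (simp add: T_def first_regen_def Z_def)
  have TR: "TR w = epoch n (Z w)" for w by (simp add: TR_def T_def next_regen_def Z_def)
  have \<Xi>1: "\<Xi>1 w = \<Xi> (Z w)" for w unfolding \<Xi>1_def T1 by (simp add: \<Xi>_def \<phi>_def Z_def)
  have nn_\<tau>: "(\<integral>\<^sup>+z. ennreal ((real (cycle_len z))\<^sup>2) \<partial>Law) < \<infinity>"
    using \<open>(\<integral>\<^sup>+w. ennreal ((real (T 1 w))^2) \<partial>M) < \<infinity>\<close> unfolding T1 by (subst (asm) nn_transfer) auto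
  have nn_\<Xi>: "(\<integral>\<^sup>+z. ennreal ((\<Xi> z)\<^sup>2) \<partial>Law) < \<infinity>"
    using \<open>(\<integral>\<^sup>+w. ennreal ((\<Xi>1 w)^2) \<partial>M) < \<infinity>\<close> unfolding \<Xi>1 by (subst (asm) nn_transfer) auto
  \<comment> \<open>The finiteness hypotheses concern extended non-negative integrals; they are
    converted so that the real integrals in \<open>\<sigma>2\<close> and \<open>n0\<close> are
    genuine moments.\<close>
  have sq: "integrable Law (\<lambda>z. (real (cycle_len z))\<^sup>2)"
    using nn_\<tau> by (intro integrableI_nonneg) auto
  have \<Xi>_sq: "integrable Law (\<lambda>z. (\<Xi> z)\<^sup>2)"
    using nn_\<Xi> by (intro integrableI_nonneg) auto
  have \<phi>_int: "integrable \<pi> \<phi>" "(\<integral>x. \<phi> x \<partial>\<pi>) = 0"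
    using \<open>integrable \<pi> f\<close> by (auto simp: \<phi>_def \<theta>_def \<pi>.prob_space)
  note centered = block_sum_centered[OF \<phi>_int \<phi>]
  have wald: "integrable Law (\<lambda>z. (S z)\<^sup>2)"
    "(\<integral>z. (S z)\<^sup>2 \<partial>Law) = (\<integral>z. (\<Xi> z)\<^sup>2 \<partial>Law) / (\<integral>z. real (cycle_len z) \<partial>Law) * (\<integral>z. real (epoch n z) \<partial>Law)"
    unfolding S_def \<Xi>_def
    by (rule wald_second_moment[OF sq \<phi> centered(1) \<Xi>_sq[unfolded \<Xi>_def] centered(2)])+
  have \<sigma>2: "\<sigma>2 = (\<integral>z. (\<Xi> z)\<^sup>2 \<partial>Law) / (\<integral>z. real (cycle_len z) \<partial>Law)"
    unfolding \<sigma>2_def T1 \<Xi>1 by (subst (1 2) transfer) auto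
  have n0: "n0 = (\<integral>z. (real (cycle_len z))\<^sup>2 \<partial>Law) / (\<integral>z. real (cycle_len z) \<partial>Law) - 1"
    unfolding n0_def T1 by (subst (1 2) transfer) auto
  define a where "a = (\<integral>z. real (epoch n z) \<partial>Law)"
  have "(\<integral>\<^sup>+w. ennreal (real (TR w)) \<partial>M) = (\<integral>\<^sup>+z. ennreal (real (epoch n z)) \<partial>Law)"
    unfolding TR by (rule nn_transfer) measurable
  also have "\<dots> = ennreal a"
    unfolding a_def by (rule nn_integral_eq_integral[OF integrable_epoch[OF sq]]) simp
  finally have ETR: "(\<integral>\<^sup>+w. ennreal (real (TR w)) \<partial>M) = ennreal a" .
  have second: "a \<le> real n + n0"
    unfolding a_def n0 by (rule expectation_epoch_le[OF sq \<open>n \<ge> 1\<close>])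
  have "(\<integral>\<^sup>+w. ennreal ((\<theta>hat w - \<theta>)\<^sup>2) \<partial>M)
      = (\<integral>\<^sup>+z. ennreal (((\<Sum>i<epoch n z. f (fst (z i))) / real (epoch n z) - \<theta>)\<^sup>2) \<partial>Law)"
  proof -
    have [measurable]: "(\<lambda>z. \<Sum>i<epoch n z. f (fst (z i))) \<in> borel_measurable path_space"
      by (rule measurable_random_sum) measurable
    have "\<theta>hat w = (\<Sum>i<epoch n (Z w). f (fst (Z w i))) / real (epoch n (Z w))" for w
      unfolding \<theta>hat_def TR by (simp add: Z_def)
    then show ?thesis by (simp only:) (rule nn_transfer, measurable)
  qed
  also have "\<dots> \<le> (\<integral>\<^sup>+z. ennreal ((S z)\<^sup>2 / (real n)\<^sup>2) \<partial>Law)"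
  \<comment> \<open>The estimation error is the centred sum divided by the random epoch. That epoch
    is at least \<open>n\<close> on almost every path, so it may be replaced by \<open>n\<close> in
    the denominator.\<close>
  proof (rule nn_integral_mono_AE)
    show "AE z in Law. ennreal (((\<Sum>i<epoch n z. f (fst (z i))) / real (epoch n z) - \<theta>)\<^sup>2)
        \<le> ennreal ((S z)\<^sup>2 / (real n)\<^sup>2)"
      using AE_inf_regen
    proof eventually_elim
      case (elim z)
      define t where "t = real (epoch n z)"
      have "epoch n z \<ge> n" using next_regen_ge[OF inf_regenD[OF elim]] .
      then have t: "real n \<le> t" "0 < t" using \<open>n \<ge> 1\<close> by (auto simp: t_def)
      have "(\<Sum>i<epoch n z. f (fst (z i))) = S z + t * \<theta>"
        by (simp add: S_def \<phi>_def sum_subtractf t_def)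
      then have "(\<Sum>i<epoch n z. f (fst (z i))) / t - \<theta> = S z / t"
        using t by (simp add: field_simps)
      moreover have "(S z)\<^sup>2 / t\<^sup>2 \<le> (S z)\<^sup>2 / (real n)\<^sup>2"
        using t \<open>n \<ge> 1\<close> by (intro divide_left_mono power_mono) auto
      ultimately show ?case
        unfolding t_def[symmetric] by (intro ennreal_leI) (simp add: power_divide)
    qed
  qed
  also have "\<dots> = ennreal (\<integral>z. (S z)\<^sup>2 / (real n)\<^sup>2 \<partial>Law)"
    using wald(1) by (intro nn_integral_eq_integral) auto
  also have "(\<integral>z. (S z)\<^sup>2 / (real n)\<^sup>2 \<partial>Law) = \<sigma>2 / (real n)\<^sup>2 * a"
    using wald(2) by (simp add: \<sigma>2 a_def)
  also have "ennreal \<dots> = ennreal (\<sigma>2 / (real n)\<^sup>2) * ennreal a"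
    by (rule ennreal_mult) (auto simp: \<sigma>2 a_def intro!: divide_nonneg_nonneg integral_nonneg_AE)
  finally show ?thesis
    unfolding ETR using second by (auto intro: ennreal_leI)
qed

end
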